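(* Let $\mu\ge 1$, $\nu\ge 0$ and let $(G,X,\Gamma)$ be a $(\mu,\nu)$-path system group. Assume that $G$ contains a constricting element. Let $H$ be an infinite index subgroup of $G$ such that: (I) $\omega_H<\infty$; (II) $H$ is divergent; (III) $H$ is quasi-convex. Then $\omega_H<\omega_G$.
   Context: A path in a metric space $X$ is a rectifiable continuous map $\alpha\colon[a,b]\to X$ parametrised by arc length; it is a $(\kappa,\lambda)$-quasi-geodesic if $d(\alpha(t),\alpha(t'))\le |t-t'|\le \kappa\, d(\alpha(t),\alpha(t'))+\lambda$ for all $t,t'\in[a,b]$. For $Y\subseteq X$, $Y^{+\eta}=\{x\in X: d(x,Y)\le\eta\}$. A $(\mu,\nu)$-path system on a geodesic metric space $X$ is a collection $\Gamma$ of paths of $X$ such that: $\Gamma$ is closed under taking subpaths; any two points of $X$ are joined by some element of $\Gamma$; every element of $\Gamma$ is a $(\mu,\nu)$-quasi-geodesic. A $(\mu,\nu)$-path system group $(G,X,\Gamma)$ is a group $G$ acting properly by isometries on a geodesic metric space $X$ (i.e. $B_G(x,r)=\{g\in G: d(x,gx)\le r\}$ is finite for all $x\in X$, $r\ge0$), together with a $G$-invariant $(\mu,\nu)$-path system $\Gamma$. A subset $Y\subseteq X$ is $\eta$-quasi-convex if every $\gamma\in\Gamma$ with endpoints in $Y$ is contained in $Y^{+\eta}$. A subgroup $H\le G$ is $\eta$-quasi-convex if there is an $H$-invariant $\eta$-quasi-convex subset $Y\subseteq X$ on which $H$ acts $\eta$-coboundedly (for all $y,y'\in Y$ there is $h\in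 H$ with $d(y,hy')\le\eta$); $H$ is quasi-convex if it is $\eta$-quasi-convex for some $\eta\ge0$. A subset $A\subseteq X$ is $\delta$-constricting if there is a map $\pi_A\colon X\to A$ such that (CS1) $d(x,\pi_A(x))\le\delta$ for all $x\in A$, and (CS2) for all $x,y\in X$ and every $\gamma\in\Gamma$ joining $x$ to $y$, if $d(\pi_A(x),\pi_A(y))>\delta$ then $\gamma$ meets both closed balls $B_X(\pi_A(x),\delta)$ and $B_X(\pi_A(y),\delta)$. An element $g\in G$ is $\delta$-constricting if it has infinite order and there is a $\langle g\rangle$-invariant $\delta$-constricting subset $A$ on which $\langle g\rangle$ acts $\delta$-coboundedly; $g$ is constricting if it is $\delta$-constricting for some $\delta\ge0$. For $o\in X$ and $H\le G$, the relative exponential growth rate is $\omega_H=\limsup_{r\to\infty}\frac1r\log|B_G(o,r)\cap H|$ (independent of $o$). The Poincaré series is $\mathcal P_H(s)=\sum_{h\in H}e^{-s\,d(o,ho)}$; $H$ is divergent if $\mathcal P_H(\omega_H)$ diverges. *)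

theory Defs
  imports "HOL-Analysis.Analysis" "HOL-Algebra.Coset"
begin

text \<open>A path is represented as a triple (a, b, alpha) with a \<le> b, where only the
values of alpha on the interval [a,b] matter.\<close>

type_synonym 'x path = "real \<times> real \<times> (real \<Rightarrow> 'x)"

definition geodesic_space :: "'x::metric_space itself \<Rightarrow> bool" where
  "geodesic_space _ \<longleftrightarrow> (\<forall>x y::'x. \<exists>\<gamma>. \<gamma> 0 = x \<and> \<gamma> (dist x y) = y \<and>
     (\<forall>s\<in>{0..dist x y}. \<forall>t\<in>{0..dist x y}. dist (\<gamma> s) (\<gamma> t) = \<bar>s - t\<bar>))"

definition curve_length :: "(real \<Rightarrow> 'x::metric_space) \<Rightarrow> real \<Rightarrow> real \<Rightarrow> ereal" where
  "curve_length \<alpha> s t = Sup {ereal (\<Sum>i<n. dist (\<alpha> (p i)) (\<alpha> (p (Suc i)))) | p n.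
       p 0 = s \<and> p n = t \<and> (\<forall>i<n. p i \<le> p (Suc i))}"

definition is_path :: "'x::metric_space path \<Rightarrow> bool" where
  "is_path P \<longleftrightarrow> (case P of (a, b, \<alpha>) \<Rightarrow> a \<le> b \<and> continuous_on {a..b} \<alpha> \<and>
     (\<forall>s t. a \<le> s \<and> s \<le> t \<and> t \<le> b \<longrightarrow> curve_length \<alpha> s t = ereal (t - s)))"

definition quasi_geodesic :: "real \<Rightarrow> real \<Rightarrow> 'x::metric_space path \<Rightarrow> bool" where
  "quasi_geodesic \<kappa> lam P \<longleftrightarrow> is_path P \<and> (case P of (a, b, \<alpha>) \<Rightarrow>
     (\<forall>t\<in>{a..b}. \<forall>t'\<in>{a..b}. dist (\<alpha> t) (\<alpha> t') \<le> \<bar>t - t'\<bar> \<and>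
        \<bar>t - t'\<bar> \<le> \<kappa> * dist (\<alpha> t) (\<alpha> t') + lam))"

definition path_joins :: "'x path \<Rightarrow> 'x \<Rightarrow> 'x \<Rightarrow> bool" where
  "path_joins P x y \<longleftrightarrow> (case P of (a, b, \<alpha>) \<Rightarrow> \<alpha> a = x \<and> \<alpha> b = y)"

definition path_image :: "'x path \<Rightarrow> 'x set" where
  "path_image P = (case P of (a, b, \<alpha>) \<Rightarrow> \<alpha> ` {a..b})"

definition same_path :: "'x path \<Rightarrow> 'x path \<Rightarrow> bool" where
  "same_path P Q \<longleftrightarrow> (case P of (a, b, \<alpha>) \<Rightarrow> case Q of (c, d, \<beta>) \<Rightarrow>
      a = c \<and> b = d \<and> (\<forall>t\<in>{a..b}. \<alpha> t = \<beta> t))"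

definition path_system :: "real \<Rightarrow> real \<Rightarrow> 'x::metric_space path set \<Rightarrow> bool" where
  "path_system \<mu> \<nu> \<Gamma> \<longleftrightarrow>
     (\<forall>(a, b, \<alpha>)\<in>\<Gamma>. \<forall>c d. a \<le> c \<and> c \<le> d \<and> d \<le> b \<longrightarrow>
         (\<exists>Q\<in>\<Gamma>. same_path Q (c, d, \<alpha>))) \<and>
     (\<forall>x y. \<exists>P\<in>\<Gamma>. path_joins P x y) \<and>
     (\<forall>P\<in>\<Gamma>. quasi_geodesic \<mu> \<nu> P)"

definition proper_isometric_action :: "('g, 'm) monoid_scheme \<Rightarrow> ('g \<Rightarrow> 'x::metric_space \<Rightarrow> 'x) \<Rightarrow> bool" where
  "proper_isometric_action G act \<longleftrightarrow>
     (\<forall>x. act \<one>\<^bsub>G\<^esub> x = x) \<and>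
     (\<forall>g\<in>carrier G. \<forall>h\<in>carrier G. \<forall>x. act (g \<otimes>\<^bsub>G\<^esub> h) x = act g (act h x)) \<and>
     (\<forall>g\<in>carrier G. \<forall>x y. dist (act g x) (act g y) = dist x y) \<and>
     (\<forall>x r. finite {g\<in>carrier G. dist x (act g x) \<le> r})"

definition invariant_path_system :: "('g, 'm) monoid_scheme \<Rightarrow> ('g \<Rightarrow> 'x \<Rightarrow> 'x) \<Rightarrow> 'x path set \<Rightarrow> bool" where
  "invariant_path_system G act \<Gamma> \<longleftrightarrow>
     (\<forall>g\<in>carrier G. \<forall>(a, b, \<alpha>)\<in>\<Gamma>. \<exists>Q\<in>\<Gamma>. same_path Q (a, b, act g \<circ> \<alpha>))"

definition path_system_group ::
  "real \<Rightarrow> real \<Rightarrow> ('g, 'm) monoid_scheme \<Rightarrow> ('g \<Rightarrow> 'x::metric_space \<Rightarrow> 'x) \<Rightarrow> 'x path set \<Rightarrow> bool" where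
  "path_system_group \<mu> \<nu> G act \<Gamma> \<longleftrightarrow> group G \<and> geodesic_space TYPE('x) \<and>
     proper_isometric_action G act \<and> path_system \<mu> \<nu> \<Gamma> \<and> invariant_path_system G act \<Gamma>"

definition nbhd :: "'x::metric_space set \<Rightarrow> real \<Rightarrow> 'x set" where
  "nbhd Y \<eta> = {x. infdist x Y \<le> \<eta>}"

definition quasi_convex_set :: "'x::metric_space path set \<Rightarrow> real \<Rightarrow> 'x set \<Rightarrow> bool" where
  "quasi_convex_set \<Gamma> \<eta> Y \<longleftrightarrow>
     (\<forall>P\<in>\<Gamma>. \<forall>x\<in>Y. \<forall>y\<in>Y. path_joins P x y \<longrightarrow> path_image P \<subseteq> nbhd Y \<eta>)"

definition acts_coboundedly :: "('g \<Rightarrow> 'x::metric_space \<Rightarrow> 'x) \<Rightarrow> 'g set \<Rightarrow> real \<Rightarrow> 'x set \<Rightarrow> bool" where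
  "acts_coboundedly act H \<eta> Y \<longleftrightarrow> (\<forall>y\<in>Y. \<forall>y'\<in>Y. \<exists>h\<in>H. dist y (act h y') \<le> \<eta>)"

definition quasi_convex_subgroup ::
  "('g, 'm) monoid_scheme \<Rightarrow> ('g \<Rightarrow> 'x::metric_space \<Rightarrow> 'x) \<Rightarrow> 'x path set \<Rightarrow> 'g set \<Rightarrow> bool" where
  "quasi_convex_subgroup G act \<Gamma> H \<longleftrightarrow> (\<exists>\<eta>\<ge>0. \<exists>Y. Y \<noteq> {} \<and>
     (\<forall>h\<in>H. act h ` Y = Y) \<and> quasi_convex_set \<Gamma> \<eta> Y \<and> acts_coboundedly act H \<eta> Y)"

definition constricting_set :: "'x::metric_space path set \<Rightarrow> real \<Rightarrow> 'x set \<Rightarrow> bool" where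
  "constricting_set \<Gamma> \<delta> A \<longleftrightarrow> (\<exists>\<pi>. (\<forall>x. \<pi> x \<in> A) \<and>
     (\<forall>x\<in>A. dist x (\<pi> x) \<le> \<delta>) \<and>
     (\<forall>x y. \<forall>P\<in>\<Gamma>. path_joins P x y \<and> dist (\<pi> x) (\<pi> y) > \<delta> \<longrightarrow>
        path_image P \<inter> cball (\<pi> x) \<delta> \<noteq> {} \<and> path_image P \<inter> cball (\<pi> y) \<delta> \<noteq> {}))"

definition cyclic_subgroup :: "('g, 'm) monoid_scheme \<Rightarrow> 'g \<Rightarrow> 'g set" where
  "cyclic_subgroup G g = {g [^]\<^bsub>G\<^esub> (k::int) | k. True}"

definition constricting_element ::
  "('g, 'm) monoid_scheme \<Rightarrow> ('g \<Rightarrow> 'x::metric_space \<Rightarrow> 'x) \<Rightarrow> 'x path set \<Rightarrow> 'g \<Rightarrow> bool" where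
  "constricting_element G act \<Gamma> g \<longleftrightarrow> g \<in> carrier G \<and>
     (\<forall>n::nat. n > 0 \<longrightarrow> g [^]\<^bsub>G\<^esub> n \<noteq> \<one>\<^bsub>G\<^esub>) \<and>
     (\<exists>\<delta>\<ge>0. \<exists>A. (\<forall>k\<in>cyclic_subgroup G g. act k ` A = A) \<and> constricting_set \<Gamma> \<delta> A \<and>
        acts_coboundedly act (cyclic_subgroup G g) \<delta> A)"

definition growth_rate ::
  "('g, 'm) monoid_scheme \<Rightarrow> ('g \<Rightarrow> 'x::metric_space \<Rightarrow> 'x) \<Rightarrow> 'x \<Rightarrow> 'g set \<Rightarrow> ereal" where
  "growth_rate G act x0 H = Limsup at_top (\<lambda>r::real.
      ereal (ln (real (card {g\<in>carrier G. dist x0 (act g x0) \<le> r \<and> g \<in> H})) / r))"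

definition divergent_subgroup ::
  "('g, 'm) monoid_scheme \<Rightarrow> ('g \<Rightarrow> 'x::metric_space \<Rightarrow> 'x) \<Rightarrow> 'x \<Rightarrow> 'g set \<Rightarrow> bool" where
  "divergent_subgroup G act x0 H \<longleftrightarrow>
     \<not> ((\<lambda>h. exp (- real_of_ereal (growth_rate G act x0 H) * dist x0 (act h x0))) summable_on H)"

end

theory Submission
  imports Defs
begin

text \<open>
  Write \<open>p\<close> for the base point. If, for every conjugate of a constricting element \<open>g\<close>, the orbit of
  \<open>H\<close> had unbounded projection to the axis, then by quasi-convexity every axis would stay close to
  the orbit of \<open>H\<close> along long segments. By pigeonhole, one power of \<open>g\<close> would have all its conjugates
  in \<open>H\<close>, so that the orbit of \<open>H\<close> would be coarsely dense in the orbit of \<open>G\<close> and \<open>H\<close> would have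
  finite index. Hence some conjugate of \<open>g\<close> has an axis \<open>A\<close> on which the orbit of \<open>H\<close> projects near \<open>p\<close>.

  Let \<open>N\<close> be the set of points that project to \<open>A\<close> near \<open>p\<close>. A large power \<open>u\<close> of the conjugate maps
  \<open>N\<close> into its complement, and by the Behrstock inequality every element of \<open>H\<close> that moves \<open>p\<close> far
  maps the complement of \<open>N\<close> into \<open>N\<close>. By ping-pong the words \<open>s\<^sub>1 u s\<^sub>2 u \<dots> s\<^sub>n u\<close> with letters in a
  separated subset of \<open>H\<close> are pairwise distinct. As \<open>H\<close> is divergent, a finite separated set \<open>F\<close> can
  be chosen with \<open>\<Sum>f\<in>F. exp (- s (d(p, f p) + d(p, u p))) > 1\<close> for some \<open>s\<close> above the growth rate of
  \<open>H\<close>; then the Poincare series of \<open>G\<close> diverges at \<open>s\<close>.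
\<close>

section \<open>Projections to constricting sets\<close>

text \<open>The body of \<open>constricting_set\<close> with the map kept as a parameter, so that
  projections can be translated by group elements and compared with one another.\<close>

definition projection_to :: "'x::metric_space path set \<Rightarrow> real \<Rightarrow> 'x set \<Rightarrow> ('x \<Rightarrow> 'x) \<Rightarrow> bool" where
  "projection_to \<Gamma> \<delta> A \<pi> \<longleftrightarrow> (\<forall>x. \<pi> x \<in> A) \<and>
     (\<forall>x\<in>A. dist x (\<pi> x) \<le> \<delta>) \<and>
     (\<forall>x y. \<forall>P\<in>\<Gamma>. path_joins P x y \<and> dist (\<pi> x) (\<pi> y) > \<delta> \<longrightarrow>
        path_image P \<inter> cball (\<pi> x) \<delta> \<noteq> {} \<and> path_image P \<inter> cball (\<pi> y) \<delta> \<noteq> {})"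

lemma constricting_set_iff_projection:
  "constricting_set \<Gamma> \<delta> A \<longleftrightarrow> (\<exists>\<pi>. projection_to \<Gamma> \<delta> A \<pi>)"
  unfolding constricting_set_def projection_to_def ..

locale path_system_space =
  fixes \<Gamma> :: "'x::metric_space path set" and \<mu> \<nu> :: real
  assumes path_sys: "path_system \<mu> \<nu> \<Gamma>" and mu_ge_1: "\<mu> \<ge> 1" and nu_nonneg: "\<nu> \<ge> 0"
begin

text \<open>An upper bound for the length of a path of \<open>\<Gamma>\<close> whose endpoints are at distance at most \<open>c\<close>.\<close>

definition qlen :: "real \<Rightarrow> real" where "qlen c = \<mu> * c + \<nu>"

lemma qlen_mono: "c \<le> d \<Longrightarrow> qlen c \<le> qlen d"
  using mu_ge_1 by (simp add: qlen_def)

lemma qlen_nonneg: "0 \<le> c \<Longrightarrow> 0 \<le> qlen c"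
  using mu_ge_1 nu_nonneg by (simp add: qlen_def)

lemma path_between: obtains a b \<alpha> where "(a, b, \<alpha>) \<in> \<Gamma>" "\<alpha> a = x" "\<alpha> b = y"
proof -
  have "\<exists>P\<in>\<Gamma>. path_joins P x y" using path_sys unfolding path_system_def by blast
  then show ?thesis using that by (auto simp: path_joins_def)
qed

lemma path_quasi_geodesic: "(a, b, \<alpha>) \<in> \<Gamma> \<Longrightarrow> quasi_geodesic \<mu> \<nu> (a, b, \<alpha>)"
  using path_sys unfolding path_system_def by blast

lemma path_le: "(a, b, \<alpha>) \<in> \<Gamma> \<Longrightarrow> a \<le> b"
  using path_quasi_geodesic by (fastforce simp: quasi_geodesic_def is_path_def)

lemma path_lipschitz:
  "(a, b, \<alpha>) \<in> \<Gamma> \<Longrightarrow> s \<in> {a..b} \<Longrightarrow> t \<in> {a..b} \<Longrightarrow> dist (\<alpha> s) (\<alpha> t) \<le> \<bar>s - t\<bar>"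
  using path_quasi_geodesic by (fastforce simp: quasi_geodesic_def)

lemma path_expansion:
  assumes "(a, b, \<alpha>) \<in> \<Gamma>" "s \<in> {a..b}" "t \<in> {a..b}" "dist (\<alpha> s) (\<alpha> t) \<le> c"
  shows "\<bar>s - t\<bar> \<le> qlen c"
proof -
  have "\<bar>s - t\<bar> \<le> qlen (dist (\<alpha> s) (\<alpha> t))"
    using path_quasi_geodesic[OF assms(1)] assms(2,3) by (auto simp: quasi_geodesic_def qlen_def)
  then show ?thesis using qlen_mono[OF assms(4)] by linarith
qed

text \<open>The quasi-geodesic inequality makes the time between \<open>s\<close> and
  \<open>t\<close> short, and paths are 1-Lipschitz. Hence a path that returns close to a point has
  not strayed far in between.\<close>

lemma path_near_endpoints:
  assumes "(a, b, \<alpha>) \<in> \<Gamma>" "s \<in> {a..b}" "t \<in> {a..b}" "r \<in> {s..t}" "dist (\<alpha> s) (\<alpha> t) \<le> c"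
  shows "dist (\<alpha> r) (\<alpha> t) \<le> qlen c"
proof -
  have "dist (\<alpha> r) (\<alpha> t) \<le> \<bar>r - t\<bar>" using path_lipschitz[OF assms(1), of r t] assms(2-4) by simp
  also have "\<dots> \<le> \<bar>s - t\<bar>" using assms(4) by simp
  finally show ?thesis using path_expansion[OF assms(1-3,5)] by linarith
qed

lemma projection_in: "projection_to \<Gamma> \<delta> A \<pi> \<Longrightarrow> \<pi> x \<in> A"
  by (simp add: projection_to_def)

lemma projection_close: "projection_to \<Gamma> \<delta> A \<pi> \<Longrightarrow> x \<in> A \<Longrightarrow> dist x (\<pi> x) \<le> \<delta>"
  by (simp add: projection_to_def)

lemma projection_delta_nonneg: "projection_to \<Gamma> \<delta> A \<pi> \<Longrightarrow> 0 \<le> \<delta>"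
  using projection_close[OF _ projection_in] by (meson order_trans zero_le_dist)

text \<open>(CS2) for a subpath. Restricting it to chosen time intervals is what later gives control
  over the order in which a path visits places.\<close>

lemma subpath_meets_balls:
  assumes "projection_to \<Gamma> \<delta> A \<pi>" "(a, b, \<alpha>) \<in> \<Gamma>" "a \<le> c" "c \<le> d" "d \<le> b"
    and far: "dist (\<pi> (\<alpha> c)) (\<pi> (\<alpha> d)) > \<delta>"
  shows "\<exists>t\<in>{c..d}. dist (\<alpha> t) (\<pi> (\<alpha> c)) \<le> \<delta>" "\<exists>t\<in>{c..d}. dist (\<alpha> t) (\<pi> (\<alpha> d)) \<le> \<delta>"
proof -
  obtain Q where Q: "Q \<in> \<Gamma>" "same_path Q (c, d, \<alpha>)"
    using path_sys assms(2-5) unfolding path_system_def by fast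
  have joins: "path_joins Q (\<alpha> c) (\<alpha> d)" and img: "path_image Q = \<alpha> ` {c..d}"
    using Q(2) \<open>c \<le> d\<close> by (auto simp: same_path_def path_joins_def path_image_def)
  have "path_image Q \<inter> cball (\<pi> (\<alpha> c)) \<delta> \<noteq> {} \<and> path_image Q \<inter> cball (\<pi> (\<alpha> d)) \<delta> \<noteq> {}"
    using assms(1) Q(1) joins far unfolding projection_to_def by blast
  then show "\<exists>t\<in>{c..d}. dist (\<alpha> t) (\<pi> (\<alpha> c)) \<le> \<delta>" "\<exists>t\<in>{c..d}. dist (\<alpha> t) (\<pi> (\<alpha> d)) \<le> \<delta>"
    unfolding img by (auto simp: dist_commute)
qed

text \<open>If the projections are more than \<delta> apart, a path from \<open>x\<close> to
  \<open>y\<close>, of length at most \<open>qlen c\<close>, comes within \<delta> of both.\<close>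

lemma projection_coarse_lipschitz:
  assumes P: "projection_to \<Gamma> \<delta> A \<pi>" and "dist x y \<le> c"
  shows "dist (\<pi> x) (\<pi> y) \<le> qlen c + 2 * \<delta>"
proof -
  obtain a b \<alpha> where p: "(a, b, \<alpha>) \<in> \<Gamma>" "\<alpha> a = x" "\<alpha> b = y" using path_between .
  have d0: "0 \<le> \<delta>" using projection_delta_nonneg[OF P] .
  have "0 \<le> c" using assms(2) zero_le_dist[of x y] by linarith
  then have q0: "0 \<le> qlen c" by (rule qlen_nonneg)
  have ab: "a \<le> b" using path_le[OF p(1)] .
  show ?thesis
  proof (cases "dist (\<pi> x) (\<pi> y) > \<delta>")
    case True
    then obtain s t where s: "s \<in> {a..b}" "dist (\<alpha> s) (\<pi> x) \<le> \<delta>"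
      and t: "t \<in> {a..b}" "dist (\<alpha> t) (\<pi> y) \<le> \<delta>"
      using subpath_meets_balls[OF P p(1) order_refl ab order_refl] unfolding p(2,3) by blast
    have "\<bar>a - b\<bar> \<le> qlen c"
      using path_expansion[OF p(1), of a b c] ab assms(2) p(2,3) by auto
    then have "dist (\<alpha> s) (\<alpha> t) \<le> qlen c"
      using path_lipschitz[OF p(1) s(1) t(1)] s(1) t(1) by auto
    moreover have "dist (\<pi> x) (\<pi> y) \<le> dist (\<alpha> s) (\<pi> x) + dist (\<alpha> s) (\<alpha> t) + dist (\<alpha> t) (\<pi> y)"
      by metric
    ultimately show ?thesis using s(2) t(2) by linarith
  qed (use d0 q0 in linarith)
qed

lemma projection_near_point:
  assumes P: "projection_to \<Gamma> \<delta> A \<pi>" and "y \<in> A" "dist x y \<le> c"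
  shows "dist (\<pi> x) y \<le> qlen c + 3 * \<delta>"
proof -
  have "dist (\<pi> x) y \<le> dist (\<pi> x) (\<pi> y) + dist y (\<pi> y)" by metric
  then show ?thesis
    using projection_coarse_lipschitz[OF P assms(3)] projection_close[OF P assms(2)] by linarith
qed

text \<open>Follow a path from \<open>x\<close> to \<pi>' x. It passes near \<pi> x at some time
  \<open>t\<close>, unless the claim is immediate. Either \<pi>' barely moves up to time
  \<open>t\<close>, or the path was already near its endpoint before \<open>t\<close>.\<close>

lemma projections_to_same_set_close:
  assumes P: "projection_to \<Gamma> \<delta> A \<pi>" and P': "projection_to \<Gamma> \<delta> A \<pi>'"
  shows "dist (\<pi> x) (\<pi>' x) \<le> qlen \<delta> + 4 * \<delta>"
proof -
  obtain a b \<alpha> where p: "(a, b, \<alpha>) \<in> \<Gamma>" "\<alpha> a = x" "\<alpha> b = \<pi>' x" using path_between .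
  have d0: "0 \<le> \<delta>" using projection_delta_nonneg[OF P] .
  have q0: "0 \<le> qlen \<delta>" using qlen_nonneg[OF d0] .
  have ab: "a \<le> b" using path_le[OF p(1)] .
  show ?thesis
  proof (cases "dist (\<pi> x) (\<pi> (\<pi>' x)) > \<delta>")
    case False
    have "dist (\<pi> x) (\<pi>' x) \<le> dist (\<pi> x) (\<pi> (\<pi>' x)) + dist (\<pi>' x) (\<pi> (\<pi>' x))" by metric
    then show ?thesis using False projection_close[OF P projection_in[OF P', of x]] d0 q0 by linarith
  next
    case True
    then obtain t where t: "t \<in> {a..b}" "dist (\<alpha> t) (\<pi> x) \<le> \<delta>"
      using subpath_meets_balls(1)[OF P p(1) order_refl ab order_refl] unfolding p(2,3) by blast
    have z: "dist (\<pi>' (\<alpha> t)) (\<pi> x) \<le> qlen \<delta> + 3 * \<delta>"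
      using projection_near_point[OF P' projection_in[OF P] t(2)] .
    show ?thesis
    proof (cases "dist (\<pi>' x) (\<pi>' (\<alpha> t)) > \<delta>")
      case False
      have "dist (\<pi> x) (\<pi>' x) \<le> dist (\<pi>' x) (\<pi>' (\<alpha> t)) + dist (\<pi>' (\<alpha> t)) (\<pi> x)" by metric
      then show ?thesis using False z by linarith
    next
      case True
      then obtain s where s: "s \<in> {a..t}" "dist (\<alpha> s) (\<pi>' x) \<le> \<delta>"
        using subpath_meets_balls(1)[OF P' p(1) order_refl, of t] t(1) unfolding p(2) by auto
      \<comment> \<open>At the times \<open>s\<close> and \<open>b\<close> the path is near \<pi>'
        x, and \<open>t\<close> lies in between.\<close>
      have "dist (\<alpha> t) (\<alpha> b) \<le> qlen \<delta>"
        using path_near_endpoints[OF p(1), of s b t \<delta>] s t(1) p(3) by auto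
      moreover have "dist (\<pi> x) (\<pi>' x) \<le> dist (\<alpha> t) (\<pi> x) + dist (\<alpha> t) (\<pi>' x)" by metric
      ultimately show ?thesis using t(2) p(3) d0 by auto
    qed
  qed
qed

text \<open>If both alternatives fail, a path from \<open>x\<close> to \<rho> x visits \<pi> x, then
  \<rho> x, then \<pi> x again, up to \<delta>. So its point near \<rho> x has projection to
  \<open>A\<close> near \<pi> x; but points near \<rho> x, a point of \<open>B\<close>, project near
  \<open>p\<close>.\<close>

lemma behrstock_inequality:
  assumes P: "projection_to \<Gamma> \<delta> A \<pi>" and R: "projection_to \<Gamma> \<delta> B \<rho>"
    and piB: "\<And>b. b \<in> B \<Longrightarrow> dist (\<pi> b) p \<le> K"
    and rhoA: "\<And>a. a \<in> A \<Longrightarrow> dist (\<rho> a) r \<le> K"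
    and K': "K' = K + qlen \<delta> + 5 * \<delta> + qlen (qlen (2 * \<delta>) + \<delta>)"
  shows "dist (\<pi> x) p \<le> K' \<or> dist (\<rho> x) r \<le> K'"
proof (rule disjCI)
  assume "\<not> dist (\<rho> x) r \<le> K'"
  then have far: "dist (\<rho> x) r > K'" by simp
  obtain a b \<alpha> where p: "(a, b, \<alpha>) \<in> \<Gamma>" "\<alpha> a = x" "\<alpha> b = \<rho> x" using path_between .
  have d0: "0 \<le> \<delta>" using projection_delta_nonneg[OF P] .
  have q0: "0 \<le> qlen \<delta>" "0 \<le> qlen (2 * \<delta>)" "0 \<le> qlen (qlen (2 * \<delta>) + \<delta>)"
    using qlen_nonneg d0 by (meson add_nonneg_nonneg mult_nonneg_nonneg zero_le_numeral)+
  have ab: "a \<le> b" using path_le[OF p(1)] .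
  have pb: "dist (\<pi> (\<rho> x)) p \<le> K" using piB[OF projection_in[OF R]] .
  show "dist (\<pi> x) p \<le> K'"
  proof (rule ccontr)
    assume "\<not> dist (\<pi> x) p \<le> K'"
    then have farp: "dist (\<pi> x) p > K'" by simp
    have "dist (\<pi> x) p \<le> dist (\<pi> x) (\<pi> (\<rho> x)) + dist (\<pi> (\<rho> x)) p" by metric
    then have "dist (\<pi> x) (\<pi> (\<rho> x)) > \<delta>" using farp pb K' q0 d0 by linarith
    then obtain t where t: "t \<in> {a..b}" "dist (\<alpha> t) (\<pi> x) \<le> \<delta>"
      using subpath_meets_balls(1)[OF P p(1) order_refl ab order_refl] unfolding p(2,3) by blast
    have "dist (\<rho> (\<alpha> t)) (\<rho> (\<pi> x)) \<le> qlen \<delta> + 2 * \<delta>"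
      using projection_coarse_lipschitz[OF R t(2)] .
    moreover have "dist (\<rho> (\<pi> x)) r \<le> K" using rhoA[OF projection_in[OF P]] .
    moreover have "dist (\<rho> x) r \<le> dist (\<rho> x) (\<rho> (\<alpha> t)) + dist (\<rho> (\<alpha> t)) (\<rho> (\<pi> x)) + dist (\<rho> (\<pi> x)) r"
      by metric
    ultimately have "dist (\<rho> x) (\<rho> (\<alpha> t)) > \<delta>" using far K' q0 d0 by linarith
    then obtain s where s: "s \<in> {a..t}" "dist (\<alpha> s) (\<rho> x) \<le> \<delta>"
      using subpath_meets_balls(1)[OF R p(1) order_refl, of t] t(1) unfolding p(2) by auto
    have w: "dist (\<pi> (\<alpha> s)) (\<pi> (\<rho> x)) \<le> qlen \<delta> + 2 * \<delta>"
      using projection_coarse_lipschitz[OF P s(2)] .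
    have tri: "dist (\<pi> x) p \<le> dist (\<pi> x) (\<pi> (\<alpha> s)) + dist (\<pi> (\<alpha> s)) (\<pi> (\<rho> x)) + dist (\<pi> (\<rho> x)) p"
      by metric
    then have "dist (\<pi> x) (\<pi> (\<alpha> s)) > \<delta>" using w farp pb K' q0 d0 by linarith
    then obtain t' where t': "t' \<in> {a..s}" "dist (\<alpha> t') (\<pi> x) \<le> \<delta>"
      using subpath_meets_balls(1)[OF P p(1) order_refl, of s] t(1) s(1) unfolding p(2) by auto
    \<comment> \<open>Times \<open>t' \<le> s \<le> t\<close>: both ends are near \<open>\<pi> x\<close>, so the point at \<open>s\<close> near \<open>\<rho> x\<close> is too.\<close>
    have "dist (\<alpha> t') (\<alpha> t) \<le> dist (\<alpha> t') (\<pi> x) + dist (\<alpha> t) (\<pi> x)" by metric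
    then have "dist (\<alpha> s) (\<alpha> t) \<le> qlen (2 * \<delta>)"
      using path_near_endpoints[OF p(1), of t' t s "2 * \<delta>"] t' s(1) t by auto
    moreover have "dist (\<alpha> s) (\<pi> x) \<le> dist (\<alpha> s) (\<alpha> t) + dist (\<alpha> t) (\<pi> x)" by metric
    ultimately have "dist (\<alpha> s) (\<pi> x) \<le> qlen (2 * \<delta>) + \<delta>" using t(2) by linarith
    from projection_near_point[OF P projection_in[OF P] this]
    have "dist (\<pi> x) (\<pi> (\<alpha> s)) \<le> qlen (qlen (2 * \<delta>) + \<delta>) + 3 * \<delta>" by (simp add: dist_commute)
    then show False using tri w pb farp K' by linarith
  qed
qed

text \<open>Take a path from \<open>x\<close> to \<open>p0\<close>. If \<rho> x is near \<rho> p0,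
  then \<open>x\<close> is near \<open>q\<close>. Otherwise the path passes near \<open>q\<close>,
  and \<pi> cannot change much before that. Applied in both directions, this supplies the hypotheses
  of \<open>behrstock_inequality\<close>.\<close>

lemma projection_bounded_of_far_basepoints:
  assumes P: "projection_to \<Gamma> \<delta> A \<pi>" and R: "projection_to \<Gamma> \<delta> B \<rho>"
    and K: "dist (\<pi> q) p0 \<le> K" "dist (\<rho> p0) q \<le> K"
    and far: "dist p0 q > qlen (qlen (\<delta> + K) + 3 * \<delta> + K) + \<delta> + K"
    and x: "x \<in> B"
  shows "dist (\<pi> x) p0 \<le> qlen (2 * \<delta> + K) + 4 * \<delta> + K"
proof -
  obtain a b \<alpha> where p: "(a, b, \<alpha>) \<in> \<Gamma>" "\<alpha> a = x" "\<alpha> b = p0" using path_between .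
  have d0: "0 \<le> \<delta>" using projection_delta_nonneg[OF P] .
  have ab: "a \<le> b" using path_le[OF p(1)] .
  have xr: "dist x (\<rho> x) \<le> \<delta>" using projection_close[OF R x] .
  show ?thesis
  proof (cases "dist (\<rho> x) (\<rho> p0) > \<delta>")
    case False
    have "dist x q \<le> dist x (\<rho> x) + dist (\<rho> x) (\<rho> p0) + dist (\<rho> p0) q" by metric
    then have "dist x q \<le> 2 * \<delta> + K" using False xr K(2) by linarith
    from projection_coarse_lipschitz[OF P this]
    have "dist (\<pi> x) (\<pi> q) \<le> qlen (2 * \<delta> + K) + 2 * \<delta>" .
    moreover have "dist (\<pi> x) p0 \<le> dist (\<pi> x) (\<pi> q) + dist (\<pi> q) p0" by metric
    ultimately show ?thesis using K(1) d0 by linarith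
  next
    case True
    then obtain t where t: "t \<in> {a..b}" "dist (\<alpha> t) (\<rho> p0) \<le> \<delta>"
      using subpath_meets_balls(2)[OF R p(1) order_refl ab order_refl] unfolding p(2,3) by blast
    have "dist (\<alpha> t) q \<le> dist (\<alpha> t) (\<rho> p0) + dist (\<rho> p0) q" by metric
    then have z: "dist (\<alpha> t) q \<le> \<delta> + K" using t(2) K(2) by linarith
    have "dist (\<pi> (\<alpha> t)) p0 \<le> dist (\<pi> (\<alpha> t)) (\<pi> q) + dist (\<pi> q) p0" by metric
    then have pz: "dist (\<pi> (\<alpha> t)) p0 \<le> qlen (\<delta> + K) + 2 * \<delta> + K"
      using projection_coarse_lipschitz[OF P z] K(1) by linarith
    have "\<not> dist (\<pi> x) (\<pi> (\<alpha> t)) > \<delta>"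
    proof
      assume "dist (\<pi> x) (\<pi> (\<alpha> t)) > \<delta>"
      then obtain s where s: "s \<in> {a..t}" "dist (\<alpha> s) (\<pi> (\<alpha> t)) \<le> \<delta>"
        using subpath_meets_balls(2)[OF P p(1) order_refl, of t] t(1) unfolding p(2) by auto
      \<comment> \<open>The path would go from near \<open>p0\<close> to near \<open>q\<close> and back to \<open>p0\<close>.\<close>
      have "dist (\<alpha> s) p0 \<le> dist (\<alpha> s) (\<pi> (\<alpha> t)) + dist (\<pi> (\<alpha> t)) p0" by metric
      then have "dist (\<alpha> s) (\<alpha> b) \<le> qlen (\<delta> + K) + 3 * \<delta> + K" using s(2) pz p(3) by simp
      then have "dist (\<alpha> t) p0 \<le> qlen (qlen (\<delta> + K) + 3 * \<delta> + K)"
        using path_near_endpoints[OF p(1), of s b t] s(1) t(1) p(3) by auto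
      moreover have "dist p0 q \<le> dist (\<alpha> t) p0 + dist (\<alpha> t) q" by metric
      ultimately show False using far z by linarith
    qed
    moreover have "dist (\<pi> x) p0 \<le> dist (\<pi> x) (\<pi> (\<alpha> t)) + dist (\<pi> (\<alpha> t)) p0" by metric
    moreover have "qlen (\<delta> + K) \<le> qlen (2 * \<delta> + K)" using d0 by (intro qlen_mono) simp
    ultimately show ?thesis using pz d0 by linarith
  qed
qed

end

section \<open>Translates of projections under the action\<close>

locale path_system_action = group G + path_system_space \<Gamma> \<mu> \<nu>
  for G :: "('g, 'm) monoid_scheme" (structure)
    and \<Gamma> :: "'x::metric_space path set" and \<mu> \<nu> :: real +
  fixes act :: "'g \<Rightarrow> 'x \<Rightarrow> 'x"
  assumes proper_act: "proper_isometric_action G act"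
    and inv_paths: "invariant_path_system G act \<Gamma>"
begin

lemma act_one [simp]: "act \<one> x = x"
  using proper_act by (simp add: proper_isometric_action_def)

lemma act_mult: "g \<in> carrier G \<Longrightarrow> h \<in> carrier G \<Longrightarrow> act (g \<otimes> h) x = act g (act h x)"
  using proper_act by (simp add: proper_isometric_action_def)

lemma act_isometry [simp]: "g \<in> carrier G \<Longrightarrow> dist (act g x) (act g y) = dist x y"
  using proper_act by (simp add: proper_isometric_action_def)

lemma finite_displacement: "finite {g \<in> carrier G. dist x (act g x) \<le> r}"
  using proper_act by (simp add: proper_isometric_action_def)

lemma act_inv_act [simp]: "g \<in> carrier G \<Longrightarrow> act (inv g) (act g x) = x"
  using act_mult[of "inv g" g x] by simp

lemma act_act_inv [simp]: "g \<in> carrier G \<Longrightarrow> act g (act (inv g) x) = x"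
  using act_mult[of g "inv g" x] by simp

lemma dist_act_left: "g \<in> carrier G \<Longrightarrow> dist (act g x) y = dist x (act (inv g) y)"
  using act_isometry[of g x "act (inv g) y"] by simp

definition translate :: "'g \<Rightarrow> ('x \<Rightarrow> 'x) \<Rightarrow> 'x \<Rightarrow> 'x" where
  "translate g \<pi> x = act g (\<pi> (act (inv g) x))"

text \<open>Pull a path back by \<open>inv g\<close>, apply (CS2) to the pulled back path and push
  the intersection points forward by the isometry.\<close>

lemma projection_translate:
  assumes P: "projection_to \<Gamma> \<delta> A \<pi>" and g: "g \<in> carrier G"
  shows "projection_to \<Gamma> \<delta> (act g ` A) (translate g \<pi>)"
proof -
  have "path_image P \<inter> cball (translate g \<pi> x) \<delta> \<noteq> {} \<and> path_image P \<inter> cball (translate g \<pi> y) \<delta> \<noteq> {}"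
    if PG: "P \<in> \<Gamma>" and J: "path_joins P x y" and far: "dist (translate g \<pi> x) (translate g \<pi> y) > \<delta>"
    for P x y
  proof -
    obtain a b \<alpha> where Pe: "P = (a, b, \<alpha>)" by (cases P)
    have p: "(a, b, \<alpha>) \<in> \<Gamma>" "\<alpha> a = x" "\<alpha> b = y" using PG J Pe by (auto simp: path_joins_def)
    have "\<exists>Q\<in>\<Gamma>. same_path Q (a, b, act (inv g) \<circ> \<alpha>)"
      using inv_paths p(1) g unfolding invariant_path_system_def by blast
    then obtain Q where Q: "Q \<in> \<Gamma>" "same_path Q (a, b, act (inv g) \<circ> \<alpha>)" by blast
    have img: "path_image Q = act (inv g) ` path_image P"
      and jo: "path_joins Q (act (inv g) x) (act (inv g) y)"
      using Q(2) Pe p(2,3) path_le[OF p(1)]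
      by (auto simp: same_path_def path_joins_def path_image_def image_image)
    have *: "path_image P \<inter> cball (translate g \<pi> z) \<delta> \<noteq> {}"
      if meets: "path_image Q \<inter> cball (\<pi> (act (inv g) z)) \<delta> \<noteq> {}" for z
    proof -
      obtain w where "w \<in> path_image P" "dist (\<pi> (act (inv g) z)) (act (inv g) w) \<le> \<delta>"
        using meets unfolding img by auto
      then show ?thesis
        using dist_act_left[OF g, of "\<pi> (act (inv g) z)" w] by (auto simp: translate_def)
    qed
    have "dist (\<pi> (act (inv g) x)) (\<pi> (act (inv g) y)) > \<delta>"
      using far g by (simp add: translate_def)
    then show ?thesis using P Q(1) jo * unfolding projection_to_def by blast
  qed
  moreover have "dist (act g x) (translate g \<pi> (act g x)) \<le> \<delta>" if "x \<in> A" for x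
    using projection_close[OF P that] g by (simp add: translate_def)
  ultimately show ?thesis
    using projection_in[OF P] unfolding projection_to_def by (auto simp: translate_def)
qed

text \<open>A projection need not commute with \<open>g\<close>; but when \<open>g\<close> preserves
  \<open>A\<close>, its translate is another projection to \<open>A\<close>, and two such
  projections are close.\<close>

lemma projection_coarsely_equivariant:
  assumes P: "projection_to \<Gamma> \<delta> A \<pi>" and g: "g \<in> carrier G" and inv: "act g ` A = A"
  shows "dist (\<pi> (act g x)) (act g (\<pi> x)) \<le> qlen \<delta> + 4 * \<delta>"
  using projections_to_same_set_close[OF P, of "translate g \<pi>" "act g x"]
    projection_translate[OF P g] g inv
  by (simp add: translate_def)

text \<open>Apply the Behrstock inequality at \<open>act h x\<close> to \<open>A\<close> and its
  translate by \<open>h\<close>, with base points \<open>p\<close> and \<open>act h p\<close>. The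
  translated projection sends \<open>act h x\<close> to \<open>act h\<close> of \<pi> x, which is
  far from \<open>act h p\<close>; so the alternative at \<open>p\<close> holds.\<close>

lemma ping_pong_near_set:
  assumes P: "projection_to \<Gamma> \<delta> A \<pi>" and H: "subgroup H G"
    and K: "\<And>h. h \<in> H \<Longrightarrow> dist (\<pi> (act h p)) p \<le> K"
  obtains K' R where "K \<le> K'"
    "\<And>h x. h \<in> H \<Longrightarrow> dist p (act h p) > R \<Longrightarrow> dist (\<pi> x) p > K' \<Longrightarrow> dist (\<pi> (act h x)) p \<le> K'"
proof -
  \<comment> \<open>\<open>R\<close> and \<open>K1\<close> are the threshold and the bound of
    \<open>projection_bounded_of_far_basepoints\<close>; \<open>K'\<close> is the Behrstock constant
    for \<open>K1\<close>.\<close>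
  define R where "R = qlen (qlen (\<delta> + K) + 3 * \<delta> + K) + \<delta> + K"
  define K1 where "K1 = qlen (2 * \<delta> + K) + 4 * \<delta> + K"
  define K' where "K' = K1 + qlen \<delta> + 5 * \<delta> + qlen (qlen (2 * \<delta>) + \<delta>)"
  have d0: "0 \<le> \<delta>" using projection_delta_nonneg[OF P] .
  have "dist (\<pi> p) p \<le> K" using K[OF subgroup.one_closed[OF H]] by simp
  then have K0: "K \<ge> 0" using zero_le_dist order_trans by blast
  have "K \<le> K'" unfolding K'_def K1_def using d0 K0
    by (auto intro!: add_nonneg_nonneg qlen_nonneg)
  moreover have "dist (\<pi> (act h x)) p \<le> K'"
    if h: "h \<in> H" and far: "dist p (act h p) > R" and x: "dist (\<pi> x) p > K'" for h x
  proof -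
    have hc: "h \<in> carrier G" using subgroup.mem_carrier[OF H h] .
    let ?B = "act h ` A" and ?\<rho> = "translate h \<pi>"
    have Q: "projection_to \<Gamma> \<delta> ?B ?\<rho>" using projection_translate[OF P hc] .
    have k1: "dist (\<pi> (act h p)) p \<le> K" using K[OF h] .
    \<comment> \<open>Translating back by \<open>inv h\<close> turns this into the bound for the
      element \<open>inv h\<close> of \<open>H\<close>.\<close>
    have k2: "dist (?\<rho> p) (act h p) \<le> K"
      using K[OF subgroup.m_inv_closed[OF H h]] hc by (simp add: translate_def)
    have "dist (\<pi> b) p \<le> K1" if "b \<in> ?B" for b
      using projection_bounded_of_far_basepoints[OF P Q k1 k2 _ that] far
      by (simp add: R_def K1_def)
    moreover have "dist (?\<rho> a) (act h p) \<le> K1" if "a \<in> A" for a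
      using projection_bounded_of_far_basepoints[OF Q P k2 k1 _ that] far
      by (simp add: R_def K1_def dist_commute)
    ultimately have "dist (\<pi> (act h x)) p \<le> K' \<or> dist (?\<rho> (act h x)) (act h p) \<le> K'"
      using behrstock_inequality[OF P Q _ _ K'_def] by blast
    then show ?thesis using x hc by (simp add: translate_def)
  qed
  ultimately show ?thesis using that by blast
qed

end

section \<open>An axis on which the subgroup has bounded projection\<close>

lemma discrete_intermediate_value:
  fixes f :: "nat \<Rightarrow> real"
  assumes "f 0 \<le> v" "v \<le> f n" "0 \<le> J" "\<And>i. i < n \<Longrightarrow> f (Suc i) \<le> f i + J"
  shows "\<exists>i\<le>n. v \<le> f i \<and> f i \<le> v + J"
  using assms
proof (induction n)
  case (Suc n)
  show ?case
  proof (cases "v \<le> f n")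
    case True
    then show ?thesis using Suc by (meson le_Suc_eq less_SucI)
  next
    case False
    then have "f (Suc n) \<le> v + J" using Suc.prems(4)[of n] by simp
    then show ?thesis using Suc.prems(2) by blast
  qed
qed auto

context path_system_space
begin

text \<open>The projection may jump, so the path is sampled at time steps of at most 1, where jumps
  are at most \<open>qlen 1\<close> plus 2 \<delta>. As \<open>v\<close> exceeds \<delta>, (CS2)
  then brings the path close to the projection found.\<close>

lemma projection_intermediate_value:
  assumes P: "projection_to \<Gamma> \<delta> A \<pi>" and p: "(a, b, \<alpha>) \<in> \<Gamma>"
    and v: "\<delta> < v" "v \<le> dist (\<pi> (\<alpha> b)) (\<pi> (\<alpha> a))"
  shows "\<exists>t\<in>{a..b}. v \<le> dist (\<pi> (\<alpha> t)) (\<pi> (\<alpha> a)) \<and>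
    dist (\<pi> (\<alpha> t)) (\<pi> (\<alpha> a)) \<le> v + (qlen 1 + 2 * \<delta>) \<and> (\<exists>s\<in>{a..b}. dist (\<alpha> s) (\<pi> (\<alpha> t)) \<le> \<delta>)"
proof -
  have ab: "a \<le> b" using path_le[OF p] .
  have d0: "0 \<le> \<delta>" using projection_delta_nonneg[OF P] .
  obtain n :: nat where "b - a < real n" using reals_Archimedean2 by blast
  then have n: "b - a \<le> real n" "n > 0" using ab by auto
  define \<tau> where "\<tau> i = a + real i * ((b - a) / real n)" for i
  have step: "(b - a) / real n \<le> 1" "0 \<le> (b - a) / real n" using n ab by (auto simp: field_simps)
  have tau: "\<tau> i \<in> {a..b}" if "i \<le> n" for i
  proof -
    have "real i * ((b - a) / real n) \<le> real n * ((b - a) / real n)"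
      using that step by (intro mult_right_mono) auto
    moreover have "0 \<le> real i * ((b - a) / real n)" using step by (intro mult_nonneg_nonneg) auto
    ultimately show ?thesis using n by (simp add: \<tau>_def)
  qed
  define f where "f i = dist (\<pi> (\<alpha> (\<tau> i))) (\<pi> (\<alpha> a))" for i
  have "f (Suc i) \<le> f i + (qlen 1 + 2 * \<delta>)" if "i < n" for i
  proof -
    have "dist (\<alpha> (\<tau> (Suc i))) (\<alpha> (\<tau> i)) \<le> \<bar>\<tau> (Suc i) - \<tau> i\<bar>"
      using path_lipschitz[OF p] tau that by simp
    also have "\<tau> (Suc i) - \<tau> i = (b - a) / real n" by (simp add: \<tau>_def distrib_right add_divide_distrib)
    also have "\<bar>(b - a) / real n\<bar> \<le> 1" using step by linarith
    finally have "dist (\<pi> (\<alpha> (\<tau> (Suc i)))) (\<pi> (\<alpha> (\<tau> i))) \<le> qlen 1 + 2 * \<delta>"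
      by (rule projection_coarse_lipschitz[OF P])
    moreover have "f (Suc i) \<le> dist (\<pi> (\<alpha> (\<tau> (Suc i)))) (\<pi> (\<alpha> (\<tau> i))) + f i"
      unfolding f_def by metric
    ultimately show ?thesis by linarith
  qed
  moreover have "f 0 \<le> v" using v d0 by (simp add: f_def \<tau>_def)
  moreover have "v \<le> f n" using v n by (simp add: f_def \<tau>_def)
  moreover have "0 \<le> qlen 1 + 2 * \<delta>" using d0 qlen_nonneg[of 1] by simp
  ultimately obtain i where i: "i \<le> n" "v \<le> f i" "f i \<le> v + (qlen 1 + 2 * \<delta>)"
    using discrete_intermediate_value[of f v n "qlen 1 + 2 * \<delta>"] by blast
  have "dist (\<pi> (\<alpha> a)) (\<pi> (\<alpha> (\<tau> i))) > \<delta>" using i(2) v(1) by (simp add: f_def dist_commute)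
  then obtain s where "s \<in> {a..\<tau> i}" "dist (\<alpha> s) (\<pi> (\<alpha> (\<tau> i))) \<le> \<delta>"
    using subpath_meets_balls(2)[OF P p order_refl, of "\<tau> i"] tau[OF i(1)] by auto
  then have "\<exists>s\<in>{a..b}. dist (\<alpha> s) (\<pi> (\<alpha> (\<tau> i))) \<le> \<delta>" using tau[OF i(1)] by auto
  then show ?thesis using i tau[OF i(1)] unfolding f_def by blast
qed

end

section \<open>Powers of an element of infinite order and their conjugates\<close>

context group
begin

lemma int_pow_inj_of_infinite_order:
  assumes "g \<in> carrier G" "\<And>n::nat. n > 0 \<Longrightarrow> g [^] n \<noteq> \<one>"
  shows "inj (\<lambda>n::int. g [^] n)"
proof -
  have False if "i < j" "g [^] i = g [^] j" for i j :: int
  proof -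
    have "g [^] (j - i) = \<one>" using that assms(1) by (simp add: int_pow_diff)
    then have "g [^] (nat (j - i)) = \<one>" using that(1) int_pow_int[of G g "nat (j - i)"] by simp
    then show False using assms(2)[of "nat (j - i)"] that(1) by simp
  qed
  then show ?thesis by (metis injI linorder_neqE)
qed

text \<open>Conjugated powers form a homomorphism from the integers. This allows exponents that
  depend on \<open>k\<close> to be replaced by one common multiple.\<close>

lemma conjugate_power_multiple_in_subgroup:
  assumes H: "subgroup H G" and k: "k \<in> carrier G" and g: "g \<in> carrier G"
    and n: "k \<otimes> g [^] (n::int) \<otimes> inv k \<in> H"
  shows "k \<otimes> g [^] (n * m) \<otimes> inv k \<in> H"
proof -
  define c where "c i = k \<otimes> g [^] (i::int) \<otimes> inv k" for i
  have add: "c (i + j) = c i \<otimes> c j" for i j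
    using k g by (simp add: c_def int_pow_mult m_assoc inv_solve_left)
  have neg: "c (- i) = inv (c i)" for i
    using k g by (simp add: c_def int_pow_neg inv_mult_group m_assoc)
  have nat: "c (n * int j) \<in> H" for j
  proof (induction j)
    case 0
    then show ?case using k subgroup.one_closed[OF H] by (simp add: c_def)
  next
    case (Suc j)
    have "c (n * int (Suc j)) = c n \<otimes> c (n * int j)"
      using add[of n "n * int j"] by (simp add: algebra_simps)
    then show ?case using Suc n subgroup.m_closed[OF H] by (simp add: c_def)
  qed
  have "c (n * m) \<in> H"
  proof (cases "m \<ge> 0")
    case True
    then show ?thesis using nat[of "nat m"] by simp
  next
    case False
    then have "c (- (n * m)) \<in> H" using nat[of "nat (- m)"] by simp
    then have "inv (c (- (n * m))) \<in> H" by (rule subgroup.m_inv_closed[OF H])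
    then show ?thesis using neg[of "- (n * m)"] by simp
  qed
  then show ?thesis by (simp add: c_def)
qed

end

context path_system_action
begin

text \<open>A path from \<open>y\<close> to \<open>act h y\<close> stays near \<open>Y\<close> by
  quasi-convexity, hence near the orbit of \<open>H\<close> by coboundedness. Its projection to
  \<open>B\<close> passes each height \<open>v\<close> up to a bounded error, and the path comes
  close to that projection.\<close>

lemma orbit_near_projection:
  assumes P: "projection_to \<Gamma> \<delta> B \<rho>"
    and Y: "\<And>h. h \<in> H \<Longrightarrow> act h ` Y = Y" "quasi_convex_set \<Gamma> \<eta> Y" "acts_coboundedly act H \<eta> Y"
    and y: "y \<in> Y"
    and v: "\<delta> < v" and h: "h \<in> H" "v \<le> dist (\<rho> (act h y)) (\<rho> y)"
  shows "\<exists>p\<in>B. \<exists>h'\<in>H. v \<le> dist p (\<rho> y) \<and> dist p (\<rho> y) \<le> v + (qlen 1 + 2 * \<delta>) \<and>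
    dist p (act h' y) \<le> \<delta> + 2 * \<eta> + 1"
proof -
  obtain a b \<alpha> where p: "(a, b, \<alpha>) \<in> \<Gamma>" "\<alpha> a = y" "\<alpha> b = act h y" using path_between .
  have hy: "act h y \<in> Y" using Y(1)[OF h(1)] y by blast
  obtain t s where t: "t \<in> {a..b}" "v \<le> dist (\<rho> (\<alpha> t)) (\<rho> y)"
      "dist (\<rho> (\<alpha> t)) (\<rho> y) \<le> v + (qlen 1 + 2 * \<delta>)"
    and s: "s \<in> {a..b}" "dist (\<alpha> s) (\<rho> (\<alpha> t)) \<le> \<delta>"
    using projection_intermediate_value[OF P p(1) v] h(2) unfolding p(2,3) by blast
  have "\<alpha> s \<in> nbhd Y \<eta>"
    using Y(2) p y hy s(1) unfolding quasi_convex_set_def path_joins_def path_image_def by fastforce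
  \<comment> \<open>The infimum need not be attained; the extra 1 provides an actual point of
    \<open>Y\<close>.\<close>
  then have "(INF z\<in>Y. dist (\<alpha> s) z) < \<eta> + 1"
    using y infdist_notempty[of Y "\<alpha> s"] by (force simp: nbhd_def)
  then obtain z where z: "z \<in> Y" "dist (\<alpha> s) z < \<eta> + 1"
    using y by (subst (asm) cINF_less_iff) (auto intro: bdd_belowI2[of _ 0])
  obtain h' where h': "h' \<in> H" "dist z (act h' y) \<le> \<eta>"
    using Y(3) z(1) y unfolding acts_coboundedly_def by blast
  have "dist (\<rho> (\<alpha> t)) (act h' y) \<le> dist (\<alpha> s) (\<rho> (\<alpha> t)) + dist (\<alpha> s) z + dist z (act h' y)"
    by metric
  then have "dist (\<rho> (\<alpha> t)) (act h' y) \<le> \<delta> + 2 * \<eta> + 1" using s(2) z(2) h'(2) by linarith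
  then show ?thesis using projection_in[OF P] t h'(1) by blast
qed

text \<open>Every translated axis is near the orbit of \<open>H\<close> at many separated heights.
  Pigeonhole on the finite set \<open>F\<close> puts the conjugate by \<open>k\<close> of some power
  of \<open>g\<close> into \<open>H\<close>, with a nonzero exponent bounded independently of
  \<open>k\<close>. So one exponent \<open>q\<close> serves all \<open>k\<close>, and cosets are
  determined by an element of \<open>F\<close> and a residue modulo \<open>q\<close>.\<close>

lemma finite_index_of_unbounded_projections:
  assumes P: "projection_to \<Gamma> \<delta> A \<pi>" and H: "subgroup H G"
    and g: "g \<in> carrier G" "\<And>n::nat. n > 0 \<Longrightarrow> g [^] n \<noteq> \<one>"
    and cob: "acts_coboundedly act (cyclic_subgroup G g) \<delta> A"
    and Y: "\<And>h. h \<in> H \<Longrightarrow> act h ` Y = Y" "quasi_convex_set \<Gamma> \<eta> Y" "acts_coboundedly act H \<eta> Y"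
    and y: "y \<in> Y"
    and unb: "\<And>k v. k \<in> carrier G \<Longrightarrow>
      \<exists>h\<in>H. v \<le> dist (translate k \<pi> (act h y)) (translate k \<pi> y)"
  shows "finite (rcosets H)"
proof -
  define a0 where "a0 = \<pi> y"
  have a0: "a0 \<in> A" using projection_in[OF P] by (simp add: a0_def)
  have d0: "0 \<le> \<delta>" using projection_delta_nonneg[OF P] .
  define J where "J = qlen 1 + 2 * \<delta>"
  have J0: "0 \<le> J" using d0 qlen_nonneg[of 1] by (simp add: J_def)
  define E where "E = \<delta> + 2 * \<eta> + 1"
  \<comment> \<open>\<open>F\<close> will contain all elements comparing an orbit point of
    \<open>H\<close> with a nearby axis point, whatever \<open>k\<close> is.\<close>
  define F where "F = {x \<in> carrier G. dist a0 (act x a0) \<le> E + \<delta> + dist a0 y}"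
  have finF: "finite F" unfolding F_def by (rule finite_displacement)
  define N where "N = card F"
  \<comment> \<open>The windows from \<open>v i\<close> to \<open>v i + J\<close> are more than 2
    \<delta> apart, so points in different windows cannot both be \<delta>-close to the same axis
    point. The offset keeps all heights above \<delta>.\<close>
  define v where "v i = \<delta> + 1 + real i * (J + 2 * \<delta> + 1)" for i
  have v_mono: "v i \<le> v l" if "i \<le> l" for i l
    using that J0 d0 by (auto simp: v_def intro!: mult_right_mono)
  have v_step: "v i + J + 2 * \<delta> + 1 \<le> v l" if "i < l" for i l
  proof -
    have "v (Suc i) \<le> v l" using that by (intro v_mono) simp
    then show ?thesis by (simp add: v_def algebra_simps)
  qed
  have v_gt: "\<delta> < v i" for i
    using v_mono[of 0 i] by (simp add: v_def)
  \<comment> \<open>Bounds the distance between two of the axis points: two heights of at most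
    \<open>v N + J\<close> and two errors \<delta>.\<close>
  define E2 where "E2 = 2 * (v N + J) + 2 * \<delta>"
  define Z where "Z = {n::int. dist a0 (act (g [^] n) a0) \<le> E2}"
  have "(\<lambda>n::int. g [^] n) ` Z \<subseteq> {x \<in> carrier G. dist a0 (act x a0) \<le> E2}"
    using g(1) by (auto simp: Z_def)
  then have "finite Z"
    using finite_displacement int_pow_inj_of_infinite_order[OF g]
    by (meson finite_imageD finite_subset inj_on_subset subset_UNIV)
  then obtain M :: nat where M: "\<And>n. n \<in> Z \<Longrightarrow> \<bar>n\<bar> \<le> int M"
  proof -
    have "n \<in> Z \<Longrightarrow> \<bar>n\<bar> \<le> Max (abs ` Z)" for n
      using \<open>finite Z\<close> by simp
    then have "n \<in> Z \<Longrightarrow> \<bar>n\<bar> \<le> int (nat (Max (abs ` Z)))" for n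
      by fastforce
    then show ?thesis using that by blast
  qed
  \<comment> \<open>The factorial is a common multiple of all nonzero exponents of absolute value at
    most \<open>M\<close>.\<close>
  define q where "q = int (fact M)"
  have q0: "q > 0" by (simp add: q_def)
  have main: "k \<otimes> g [^] q \<otimes> inv k \<in> H \<and> (\<exists>j::int. \<exists>h\<in>H. inv h \<otimes> k \<otimes> g [^] j \<in> F)"
    if k: "k \<in> carrier G" for k
  proof -
    let ?\<rho> = "translate k \<pi>"
    have "\<exists>p h j. h \<in> H \<and> v i \<le> dist p (?\<rho> y) \<and> dist p (?\<rho> y) \<le> v i + J \<and>
      dist p (act h y) \<le> E \<and> dist p (act k (act (g [^] (j::int)) a0)) \<le> \<delta>" for i
    proof -
      obtain h0 where h0: "h0 \<in> H" "v i \<le> dist (?\<rho> (act h0 y)) (?\<rho> y)" using unb[OF k] by blast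
      obtain p h where p: "p \<in> act k ` A" and h: "h \<in> H" "v i \<le> dist p (?\<rho> y)"
          "dist p (?\<rho> y) \<le> v i + J" "dist p (act h y) \<le> E"
        using orbit_near_projection[OF projection_translate[OF P k] Y y v_gt[of i] h0]
        unfolding E_def J_def by blast
      obtain a where a: "a \<in> A" "p = act k a" using p by blast
      obtain j :: int where "dist a (act (g [^] j) a0) \<le> \<delta>"
        using cob a(1) a0 unfolding acts_coboundedly_def cyclic_subgroup_def by blast
      then have "dist p (act k (act (g [^] j) a0)) \<le> \<delta>" using a(2) k by simp
      then show ?thesis using h by blast
    qed
    then obtain p h j where h: "\<And>i. h i \<in> H" and p: "\<And>i. v i \<le> dist (p i) (?\<rho> y)"
        "\<And>i. dist (p i) (?\<rho> y) \<le> v i + J" "\<And>i. dist (p i) (act (h i) y) \<le> E"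
      and j: "\<And>i. dist (p i) (act k (act (g [^] (j i :: int)) a0)) \<le> \<delta>" by metis
    have hc: "h i \<in> carrier G" for i using subgroup.mem_carrier[OF H h] .
    define x where "x i = inv (h i) \<otimes> k \<otimes> g [^] j i" for i
    have xF: "x i \<in> F" for i
    proof -
      have "dist (act (x i) a0) y = dist (act k (act (g [^] j i) a0)) (act (h i) y)"
        using hc k g(1) dist_act_left[of "inv (h i)"] by (simp add: x_def act_mult)
      also have "\<dots> \<le> dist (p i) (act k (act (g [^] j i) a0)) + dist (p i) (act (h i) y)" by metric
      finally have "dist (act (x i) a0) y \<le> \<delta> + E" using p(3)[of i] j[of i] by linarith
      moreover have "dist a0 (act (x i) a0) \<le> dist (act (x i) a0) y + dist a0 y" by metric
      ultimately show ?thesis using hc k g(1) by (simp add: F_def x_def)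
    qed
    \<comment> \<open>There are \<open>N + 1\<close> indices but only \<open>N\<close> elements in
      \<open>F\<close>.\<close>
    have "\<not> inj_on x {..N}"
    proof
      assume "inj_on x {..N}"
      then have "card {..N} \<le> card F" using xF finF by (intro card_inj_on_le[of x]) auto
      then show False by (simp add: N_def)
    qed
    then obtain i l where il: "i < l" "l \<le> N" "x i = x l"
      unfolding inj_on_def by (metis atMost_iff linorder_neqE_nat)
    define n where "n = j i - j l"
    have "dist (p l) (?\<rho> y) \<le> dist (p i) (p l) + dist (p i) (?\<rho> y)" by metric
    then have far: "dist (p i) (p l) > 2 * \<delta>"
      using p(1)[of l] p(2)[of i] v_step[OF il(1)] by linarith
    have "n \<noteq> 0"
    proof
      assume "n = 0"
      then have "dist (p l) (act k (act (g [^] j i) a0)) \<le> \<delta>" using j[of l] by (simp add: n_def)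
      moreover have "dist (p i) (p l) \<le>
        dist (p i) (act k (act (g [^] j i) a0)) + dist (p l) (act k (act (g [^] j i) a0))" by metric
      ultimately show False using j[of i] far by linarith
    qed
    have "n \<in> Z"
    proof -
      have "dist a0 (act (g [^] n) a0) = dist (act (g [^] j l) a0) (act (g [^] j l) (act (g [^] n) a0))"
        using g(1) by simp
      also have "act (g [^] j l) (act (g [^] n) a0) = act (g [^] j i) a0"
        using g(1) by (simp add: n_def flip: act_mult int_pow_mult)
      also have "dist (act (g [^] j l) a0) (act (g [^] j i) a0) =
          dist (act k (act (g [^] j l) a0)) (act k (act (g [^] j i) a0))" using k by simp
      also have "\<dots> \<le> dist (p l) (act k (act (g [^] j l) a0)) + dist (p l) (?\<rho> y) + dist (p i) (?\<rho> y)
          + dist (p i) (act k (act (g [^] j i) a0))"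
        using dist_triangle2[of "act k (act (g [^] j l) a0)" "act k (act (g [^] j i) a0)" "p l"]
          dist_triangle[of "p l" "act k (act (g [^] j i) a0)" "?\<rho> y"]
          dist_triangle[of "?\<rho> y" "act k (act (g [^] j i) a0)" "p i"]
        by (simp add: dist_commute)
      also have "\<dots> \<le> E2"
        using j[of l] j[of i] p(2)[of l] p(2)[of i] v_mono[of i N] v_mono[of l N] il
        by (simp add: E2_def)
      finally show ?thesis by (simp add: Z_def)
    qed
    have "k \<otimes> g [^] n \<otimes> inv k = h i \<otimes> inv (h l)"
    proof -
      have e: "k \<otimes> g [^] j m = h m \<otimes> x m" for m
        using hc k g(1) by (simp add: x_def inv_solve_left' flip: m_assoc)
      have xc: "x i \<in> carrier G" using xF by (simp add: F_def)
      have "k \<otimes> g [^] n \<otimes> inv k = (k \<otimes> g [^] j i) \<otimes> inv (k \<otimes> g [^] j l)"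
        using k g(1) by (simp add: n_def int_pow_diff inv_mult_group m_assoc)
      also have "\<dots> = (h i \<otimes> x i) \<otimes> inv (h l \<otimes> x i)" using e[of i] e[of l] il(3) by simp
      also have "\<dots> = h i \<otimes> (x i \<otimes> (inv (x i) \<otimes> inv (h l)))"
        using hc xc by (simp add: inv_mult_group m_assoc)
      also have "x i \<otimes> (inv (x i) \<otimes> inv (h l)) = inv (h l)"
        using hc xc by (simp flip: m_assoc)
      finally show ?thesis .
    qed
    then have "k \<otimes> g [^] n \<otimes> inv k \<in> H"
      using h H by (simp add: subgroup.m_closed subgroup.m_inv_closed)
    moreover have "n dvd q"
    proof -
      have "nat \<bar>n\<bar> dvd fact M" using M[OF \<open>n \<in> Z\<close>] \<open>n \<noteq> 0\<close> by (intro dvd_fact) auto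
      then have "int (nat \<bar>n\<bar>) dvd q" unfolding q_def by (simp only: int_dvd_int_iff)
      then show ?thesis by simp
    qed
    ultimately have "k \<otimes> g [^] q \<otimes> inv k \<in> H"
      using conjugate_power_multiple_in_subgroup[OF H k g(1)] by (auto elim!: dvdE)
    then show ?thesis using xF h unfolding x_def by blast
  qed
  have "rcosets H \<subseteq> (\<lambda>(f, r). H #> (f \<otimes> inv (g [^] r))) ` (F \<times> {0..<q})"
  proof
    fix C assume "C \<in> rcosets H"
    then obtain k where k: "k \<in> carrier G" "C = H #> k" unfolding RCOSETS_def by blast
    obtain j :: int and h where h: "h \<in> H" "inv h \<otimes> k \<otimes> g [^] j \<in> F" using main[OF k(1)] by blast
    \<comment> \<open>Split \<open>j\<close> into a multiple of \<open>q\<close> and a remainder.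
      The multiple, conjugated by \<open>k\<close>, lies in \<open>H\<close> and is absorbed by the
      coset, so only the remainder survives.\<close>
    define c where "c = k \<otimes> g [^] (q * (j div q)) \<otimes> inv k"
    have c: "c \<in> H" unfolding c_def
      using conjugate_power_multiple_in_subgroup[OF H k(1) g(1)] main[OF k(1)] by blast
    have cc: "c \<in> carrier G" "h \<in> carrier G" using subgroup.mem_carrier[OF H] c h(1) by auto
    let ?f = "inv h \<otimes> k \<otimes> g [^] j"
    have "?f \<otimes> inv (g [^] (j mod q)) = (inv h \<otimes> c) \<otimes> k"
    proof -
      have "g [^] j = g [^] (q * (j div q)) \<otimes> g [^] (j mod q)"
        using g(1) by (simp flip: int_pow_mult)
      then show ?thesis using k(1) g(1) cc by (simp add: c_def m_assoc)
    qed
    moreover have "H #> ((inv h \<otimes> c) \<otimes> k) = H #> k"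
    proof -
      have "inv h \<otimes> c \<in> H" using H c h(1) by (simp add: subgroup.m_closed subgroup.m_inv_closed)
      then have "H #> (inv h \<otimes> c) = H" using coset_join2 H cc by simp
      then show ?thesis using coset_mult_assoc[OF subgroup.subset[OF H], of "inv h \<otimes> c" k] cc k(1) by simp
    qed
    ultimately have "C = H #> (?f \<otimes> inv (g [^] (j mod q)))" using k(2) by simp
    moreover have "j mod q \<in> {0..<q}" using q0 by simp
    ultimately show "C \<in> (\<lambda>(f, r). H #> (f \<otimes> inv (g [^] r))) ` (F \<times> {0..<q})"
      using h(2) by force
  qed
  then show ?thesis using finF finite_subset by blast
qed

end

section \<open>Ping-pong and Poincare series\<close>

text \<open>Expanding the power by distributivity gives one product for each word of length
  \<open>n\<close>.\<close>

lemma sum_prod_list_fixed_length: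
  fixes f :: "'a \<Rightarrow> 'b::comm_semiring_1"
  assumes "finite F"
  shows "(\<Sum>l | set l \<subseteq> F \<and> length l = n. \<Prod>s\<leftarrow>l. f s) = (\<Sum>s\<in>F. f s) ^ n"
proof (induction n)
  case 0
  have "{l. set l \<subseteq> F \<and> length l = 0} = {[]}" by auto
  then show ?case by simp
next
  case (Suc n)
  let ?L = "{l. set l \<subseteq> F \<and> length l = n}"
  have "(\<Sum>l | set l \<subseteq> F \<and> length l = Suc n. \<Prod>s\<leftarrow>l. f s)
      = (\<Sum>(l, x)\<in>?L \<times> F. (\<Prod>s\<leftarrow>x # l. f s))"
    unfolding lists_length_Suc_eq
    by (subst sum.reindex) (auto simp: inj_on_def intro!: sum.cong)
  also have "\<dots> = (\<Sum>(l, x)\<in>?L \<times> F. (\<Prod>s\<leftarrow>l. f s) * f x)"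
    by (simp add: mult.commute)
  also have "\<dots> = (\<Sum>l\<in>?L. \<Prod>s\<leftarrow>l. f s) * (\<Sum>x\<in>F. f x)"
    by (simp only: sum_product sum.cartesian_product)
  finally show ?case using Suc by (simp add: mult.commute)
qed

section \<open>Ping-pong words and their displacement\<close>

context group
begin

primrec alternating_word :: "'a \<Rightarrow> 'a list \<Rightarrow> 'a" where
  "alternating_word u [] = \<one>"
| "alternating_word u (s # l) = s \<otimes> (u \<otimes> alternating_word u l)"

lemma alternating_word_closed:
  "u \<in> carrier G \<Longrightarrow> set l \<subseteq> carrier G \<Longrightarrow> alternating_word u l \<in> carrier G"
  by (induction l) auto

end

context path_system_action
begin

text \<open>Nonempty words are compared by first letter. Equal letters cancel; for distinct letters
  \<open>s\<close>, \<open>s'\<close>, the map of \<open>inv s \<otimes> s'\<close> would send a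
  point outside \<open>N\<close> to a point outside \<open>N\<close>, against \<open>sep\<close>.
  The hypothesis \<open>invp\<close> separates nonempty words from the empty one.\<close>

lemma ping_pong_alternating_word_inj:
  assumes u: "u \<in> carrier G" and S: "S \<subseteq> carrier G"
    and p: "p \<in> N"
    and uN: "\<And>x. x \<in> N \<Longrightarrow> act u x \<notin> N"
    and sN: "\<And>s x. s \<in> S \<Longrightarrow> x \<notin> N \<Longrightarrow> act s x \<in> N"
    and sep: "\<And>s s' x. s \<in> S \<Longrightarrow> s' \<in> S \<Longrightarrow> s \<noteq> s' \<Longrightarrow> x \<notin> N \<Longrightarrow> act (inv s \<otimes> s') x \<in> N"
    and invp: "\<And>s. s \<in> S \<Longrightarrow> act (inv s) p \<in> N"
  shows "inj_on (alternating_word u) (lists S)"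
proof -
  let ?w = "alternating_word u"
  have wc: "?w l \<in> carrier G" if "l \<in> lists S" for l
    using that S u by (intro alternating_word_closed) auto
  have wN: "act (?w l) p \<in> N" if "l \<in> lists S" for l
    using that
  proof (induction l)
    case (Cons s l)
    then have "act (?w (s # l)) p = act s (act u (act (?w l) p))"
      using u S wc[of l] by (auto simp: act_mult)
    then show ?case using Cons uN sN by auto
  qed (use p in simp)
  have uwN: "act (u \<otimes> ?w l) p \<notin> N" if "l \<in> lists S" for l
    using uN[OF wN[OF that]] u wc[OF that] by (simp add: act_mult)
  have ne: "\<one> \<noteq> s \<otimes> (u \<otimes> ?w l)" if "s \<in> S" "l \<in> lists S" for s l
  proof
    assume eq: "\<one> = s \<otimes> (u \<otimes> ?w l)"
    have c: "s \<in> carrier G" "u \<otimes> ?w l \<in> carrier G" using that S u wc by auto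
    then have "u \<otimes> ?w l = inv s" using eq by (metis inv_equality inv_inv m_closed inv_comm)
    then show False using invp[OF that(1)] uwN[OF that(2)] by simp
  qed
  have "l = l'" if "l \<in> lists S" "l' \<in> lists S" "?w l = ?w l'" for l l'
    using that
  proof (induction l arbitrary: l' rule: list.induct)
    case Nil
    then show ?case using ne by (cases l') auto
  next
    case (Cons s l)
    show ?case
    proof (cases l')
      case Nil
      have "s \<in> S" "l \<in> lists S" using Cons.prems(1) by auto
      then show ?thesis using Cons.prems(3) ne[of s l] Nil by simp
    next
      case l': (Cons s' m)
      have ls: "s \<in> S" "s' \<in> S" "l \<in> lists S" "m \<in> lists S" using l' Cons.prems by auto
      then have c: "s \<in> carrier G" "s' \<in> carrier G" "u \<otimes> ?w l \<in> carrier G" "u \<otimes> ?w m \<in> carrier G"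
        "?w l \<in> carrier G" "?w m \<in> carrier G" using S u wc by auto
      have eq: "s \<otimes> (u \<otimes> ?w l) = s' \<otimes> (u \<otimes> ?w m)" using Cons.prems(3) l' by simp
      have "s = s'"
      proof (rule ccontr)
        assume "s \<noteq> s'"
        have "act s (act (u \<otimes> ?w l) p) = act s' (act (u \<otimes> ?w m) p)"
          using eq c by (metis act_mult)
        then have "act (u \<otimes> ?w l) p = act (inv s \<otimes> s') (act (u \<otimes> ?w m) p)"
          using c by (metis act_inv_act act_mult inv_closed)
        then show False using sep[OF ls(1,2) \<open>s \<noteq> s'\<close> uwN[OF ls(4)]] uwN[OF ls(3)] by simp
      qed
      then have "?w l = ?w m" using eq c u by simp
      then show ?thesis using Cons.IH[OF ls(3,4)] \<open>s = s'\<close> l' by simp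
    qed
  qed
  then show ?thesis unfolding inj_on_def by blast
qed

lemma displacement_mult:
  assumes "g \<in> carrier G" "h \<in> carrier G"
  shows "dist p (act (g \<otimes> h) p) \<le> dist p (act g p) + dist p (act h p)"
  using assms dist_triangle[of p "act g (act h p)" "act g p"] by (simp add: act_mult)

lemma displacement_inv: "g \<in> carrier G \<Longrightarrow> dist p (act (inv g) p) = dist p (act g p)"
  using dist_act_left[of g p p] by (simp add: dist_commute)

lemma displacement_alternating_word:
  assumes u: "u \<in> carrier G" and "set l \<subseteq> carrier G"
  shows "dist p (act (alternating_word u l) p) \<le> (\<Sum>s\<leftarrow>l. dist p (act s p) + dist p (act u p))"
  using assms(2)
proof (induction l)
  case (Cons s l)
  have c: "s \<in> carrier G" "alternating_word u l \<in> carrier G"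
    using Cons.prems alternating_word_closed[OF u, of l] by auto
  then show ?case
    using Cons displacement_mult[of s "u \<otimes> alternating_word u l" p]
      displacement_mult[of u "alternating_word u l" p] u by auto
qed simp

text \<open>Choose \<open>s'\<close> between the growth rate and \<open>s\<close>. Balls of large
  radius \<open>r\<close> have at most \<open>exp (s' * r)\<close> elements, so the sum over unit
  shells is dominated by a geometric series of ratio \<open>exp (s' - s)\<close>.\<close>

lemma poincare_sums_bounded:
  assumes gr: "growth_rate G act p (carrier G) < ereal s" and s: "0 \<le> s"
  shows "\<exists>M. \<forall>T. finite T \<and> T \<subseteq> carrier G \<longrightarrow> (\<Sum>g\<in>T. exp (- s * dist p (act g p))) \<le> M"
proof -
  let ?d = "\<lambda>g. dist p (act g p)"
  let ?B = "\<lambda>r. {g \<in> carrier G. ?d g \<le> r}"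
  obtain s' where s': "growth_rate G act p (carrier G) < ereal s'" "s' < s"
    using ereal_dense2[OF gr] by auto
  have fin: "finite (?B r)" for r by (rule finite_displacement)
  have "\<forall>\<^sub>F r in at_top. ereal (ln (real (card {g \<in> carrier G. ?d g \<le> r \<and> g \<in> carrier G})) / r) < ereal s'"
    using s'(1) unfolding growth_rate_def by (rule Limsup_lessD)
  moreover have "{g \<in> carrier G. ?d g \<le> r \<and> g \<in> carrier G} = ?B r" for r by auto
  ultimately have "\<forall>\<^sub>F r in at_top. ln (real (card (?B r))) / r < s'" by simp
  then have "\<forall>\<^sub>F r in at_top. real (card (?B r)) \<le> exp (s' * r)"
    using eventually_gt_at_top[of 0]
  proof eventually_elim
    case (elim r)
    have "\<one> \<in> ?B r" using elim by simp
    then have "card (?B r) > 0" using fin[of r] card_gt_0_iff by blast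
    then have "real (card (?B r)) = exp (ln (real (card (?B r))))" by simp
    also have "\<dots> \<le> exp (s' * r)" using elim by (simp add: field_simps)
    finally show ?case .
  qed
  then have "\<forall>\<^sub>F n in sequentially. real (card (?B (real (Suc n)))) \<le> exp (s' * real (Suc n))"
    by (rule eventually_compose_filterlim)
      (rule filterlim_compose[OF filterlim_real_sequentially filterlim_Suc])
  then have ev: "\<forall>\<^sub>F n in sequentially.
      norm (real (card (?B (real (Suc n)))) * exp (- s * real n)) \<le> exp s' * exp (s' - s) ^ n"
  proof eventually_elim
    case (elim n)
    have "real (card (?B (real (Suc n)))) * exp (- s * real n) \<le> exp (s' * real (Suc n)) * exp (- s * real n)"
      using elim by (intro mult_right_mono) auto
    also have "\<dots> = exp s' * exp (s' - s) ^ n"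
      by (simp add: algebra_simps flip: exp_add exp_of_nat_mult)
    finally show ?case by simp
  qed
  \<comment> \<open>Bounds the contribution of the shell of displacements in [n, n+1), which lies in
    the ball of radius \<open>Suc n\<close>.\<close>
  define a where "a n = real (card (?B (real (Suc n)))) * exp (- s * real n)" for n
  have "summable (\<lambda>n. exp s' * exp (s' - s) ^ n)"
    using s'(2) by (intro summable_mult summable_geometric) simp
  then have sa: "summable a"
    unfolding a_def by (rule summable_comparison_test_ev[OF ev])
  have "(\<Sum>g\<in>T. exp (- s * ?d g)) \<le> suminf a" if T: "finite T" "T \<subseteq> carrier G" for T
  proof -
    let ?n = "\<lambda>g. nat \<lfloor>?d g\<rfloor>"
    have "(\<Sum>g\<in>T. exp (- s * ?d g)) = (\<Sum>n\<in>?n ` T. \<Sum>g | g \<in> T \<and> ?n g = n. exp (- s * ?d g))"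
      by (rule sum.image_gen[OF T(1)])
    also have "\<dots> \<le> (\<Sum>n\<in>?n ` T. a n)"
    proof (rule sum_mono)
      fix n
      have sub: "{g. g \<in> T \<and> ?n g = n} \<subseteq> ?B (real (Suc n))"
      proof clarify
        fix g assume "g \<in> T"
        then show "g \<in> carrier G \<and> ?d g \<le> real (Suc (?n g))"
          using T(2) real_of_int_floor_add_one_ge[of "?d g"] by (auto simp: add.commute)
      qed
      have "(\<Sum>g | g \<in> T \<and> ?n g = n. exp (- s * ?d g)) \<le> (\<Sum>g | g \<in> T \<and> ?n g = n. exp (- s * real n))"
        using s by (intro sum_mono) (auto intro!: mult_left_mono)
      also have "\<dots> = real (card {g. g \<in> T \<and> ?n g = n}) * exp (- s * real n)" by simp
      also have "\<dots> \<le> a n" unfolding a_def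
        using card_mono[OF fin sub] by (intro mult_right_mono) auto
      finally show "(\<Sum>g | g \<in> T \<and> ?n g = n. exp (- s * ?d g)) \<le> a n" .
    qed
    also have "\<dots> \<le> suminf a" using T(1) by (intro sum_le_suminf sa) (auto simp: a_def)
    finally show ?thesis .
  qed
  then show ?thesis by blast
qed

text \<open>Words of each length contribute at least 1 to the Poincare sum of \<open>G\<close> at
  \<open>s\<close>, and by injectivity no element is counted twice. The partial sums are therefore
  unbounded, which is impossible above the growth rate.\<close>

lemma growth_rate_ge_of_inj_alternating_word:
  assumes F: "finite F" "F \<subseteq> carrier G" and u: "u \<in> carrier G"
    and inj: "inj_on (alternating_word u) (lists F)" and s: "0 \<le> s"
    and ge: "1 \<le> (\<Sum>f\<in>F. exp (- s * (dist p (act f p) + dist p (act u p))))"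
  shows "ereal s \<le> growth_rate G act p (carrier G)"
proof (rule ccontr)
  assume "\<not> ereal s \<le> growth_rate G act p (carrier G)"
  then have gr: "growth_rate G act p (carrier G) < ereal s" by simp
  obtain M where M: "\<And>T. finite T \<Longrightarrow> T \<subseteq> carrier G \<Longrightarrow> (\<Sum>g\<in>T. exp (- s * dist p (act g p))) \<le> M"
    using poincare_sums_bounded[OF gr s] by meson
  obtain m :: nat where m: "M < real m" using reals_Archimedean2 by blast
  let ?W = "\<lambda>n. {l. set l \<subseteq> F \<and> length l = n}"
  let ?w = "alternating_word u"
  define len where "len f = dist p (act f p) + dist p (act u p)" for f
  let ?\<phi> = "\<lambda>f. exp (- s * len f)"
  let ?U = "\<Union>n\<in>{..<m}. ?W n"
  have finW: "finite (?W n)" for n using finite_lists_length_eq[OF F(1)] .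
  have lower: "(\<Prod>f\<leftarrow>l. ?\<phi> f) \<le> exp (- s * dist p (act (?w l) p))" if "set l \<subseteq> F" for l
  proof -
    have "(\<Prod>f\<leftarrow>l. ?\<phi> f) = exp (- s * (\<Sum>f\<leftarrow>l. len f))"
      by (induction l) (simp_all add: distrib_left flip: exp_add)
    then show ?thesis
      using displacement_alternating_word[OF u, of l p] that F(2) s
      by (auto simp: len_def intro!: mult_left_mono)
  qed
  have "real m \<le> (\<Sum>n<m. (\<Sum>f\<in>F. ?\<phi> f) ^ n)"
    using sum_mono[of "{..<m}" "\<lambda>_. 1" "\<lambda>n. (\<Sum>f\<in>F. ?\<phi> f) ^ n"] ge
    by (simp add: len_def one_le_power)
  also have "\<dots> = (\<Sum>n<m. \<Sum>l\<in>?W n. \<Prod>f\<leftarrow>l. ?\<phi> f)"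
    by (simp only: sum_prod_list_fixed_length[OF F(1)])
  also have "\<dots> \<le> (\<Sum>n<m. \<Sum>l\<in>?W n. exp (- s * dist p (act (?w l) p)))"
    by (intro sum_mono lower) auto
  also have "\<dots> = (\<Sum>l\<in>?U. exp (- s * dist p (act (?w l) p)))"
    using finW by (intro sum.UNION_disjoint[symmetric]) auto
  also have "\<dots> = (\<Sum>g\<in>?w ` ?U. exp (- s * dist p (act g p)))"
  proof -
    have "inj_on ?w ?U" by (rule inj_on_subset[OF inj]) auto
    then show ?thesis by (simp add: sum.reindex)
  qed
  also have "\<dots> \<le> M"
    using finW F(2) alternating_word_closed[OF u] by (intro M) auto
  finally show False using m by simp
qed

text \<open>Take a maximal \<open>R\<close>-separated subset \<open>F\<close> of a finite set with
  large sum. By maximality that set is covered by the products of \<open>F\<close> with the ball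
  \<open>B\<close>, so passing to \<open>F\<close> loses at most the constant factor
  \<open>D\<close>.\<close>

lemma separated_set_with_large_poincare_sum:
  assumes H: "subgroup H G" and w: "0 \<le> w" and R: "0 \<le> R"
    and div: "\<not> (\<lambda>h. exp (- w * dist p (act h p))) summable_on H"
  obtains F where "finite F" "F \<subseteq> H" "\<And>f. f \<in> F \<Longrightarrow> dist p (act f p) > R"
    "\<And>f f'. f \<in> F \<Longrightarrow> f' \<in> F \<Longrightarrow> f \<noteq> f' \<Longrightarrow> dist p (act (inv f \<otimes> f') p) > R"
    "C \<le> (\<Sum>f\<in>F. exp (- w * dist p (act f p)))"
proof -
  let ?d = "\<lambda>g. dist p (act g p)"
  let ?e = "\<lambda>g. exp (- w * ?d g)"
  have Hc: "H \<subseteq> carrier G" using subgroup.subset[OF H] .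
  define B where "B = {g \<in> carrier G. ?d g \<le> R}"
  have finB: "finite B" unfolding B_def by (rule finite_displacement)
  have "\<one> \<in> B" using R by (simp add: B_def)
  then have cardB: "card B > 0" using finB card_gt_0_iff by blast
  define D where "D = real (card B) * exp (w * R)"
  have D0: "D > 0" using cardB by (simp add: D_def)
  \<comment> \<open>The summand \<open>sum ?e B\<close> pays for the removal of \<open>B\<close>
    from \<open>T\<close>, which makes every remaining displacement exceed \<open>R\<close>.\<close>
  obtain T where T: "finite T" "T \<subseteq> H" "sum ?e T > C * D + sum ?e B"
  proof -
    have "\<not> (\<forall>T. finite T \<and> T \<subseteq> H \<longrightarrow> sum ?e T \<le> C * D + sum ?e B)"
    proof
      assume "\<forall>T. finite T \<and> T \<subseteq> H \<longrightarrow> sum ?e T \<le> C * D + sum ?e B"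
      then have "?e summable_on H"
        by (intro nonneg_bdd_above_summable_on) (auto intro!: bdd_aboveI2)
      then show False using div by simp
    qed
    then show ?thesis using that by (meson not_le)
  qed
  define T' where "T' = T - B"
  have T': "finite T'" "T' \<subseteq> H" using T by (auto simp: T'_def)
  have "sum ?e T \<le> sum ?e (T' \<union> B)" using T finB by (intro sum_mono2) (auto simp: T'_def)
  also have "\<dots> = sum ?e T' + sum ?e B" using T' finB by (intro sum.union_disjoint) (auto simp: T'_def)
  finally have sT': "sum ?e T' > C * D" using T(3) by linarith
  define sep where "sep F \<longleftrightarrow> (\<forall>f\<in>F. \<forall>f'\<in>F. f \<noteq> f' \<longrightarrow> ?d (inv f \<otimes> f') > R)" for F
  define \<F> where "\<F> = {F. F \<subseteq> T' \<and> sep F}"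
  have "finite \<F>" using T'(1) unfolding \<F>_def by (auto intro: finite_subset[of _ "Pow T'"])
  moreover have "{} \<in> \<F>" by (simp add: sep_def \<F>_def)
  ultimately obtain F where "F \<in> \<F>" "\<forall>F'\<in>\<F>. F \<subseteq> F' \<longrightarrow> F = F'"
    using finite_has_maximal[of \<F>] by (metis empty_iff)
  then have F: "F \<subseteq> T'" "sep F"
    and max: "\<And>F'. F' \<subseteq> T' \<Longrightarrow> sep F' \<Longrightarrow> F \<subseteq> F' \<Longrightarrow> F = F'"
    by (simp_all add: \<F>_def)
  have Fc: "F \<subseteq> carrier G" using F(1) T'(2) Hc by auto
  have finF: "finite F" using F(1) T'(1) finite_subset by blast
  have cover: "\<exists>f\<in>F. inv f \<otimes> t \<in> B" if t: "t \<in> T'" for t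
  proof (rule ccontr)
    assume neg: "\<not> (\<exists>f\<in>F. inv f \<otimes> t \<in> B)"
    have tc: "t \<in> carrier G" using t T'(2) Hc by auto
    have a: "?d (inv f \<otimes> t) > R" if "f \<in> F" for f
      using neg that tc Fc by (auto simp: B_def not_le)
    \<comment> \<open>Separation is required for both orders of a pair; an inverse has the same
      displacement.\<close>
    have b: "?d (inv t \<otimes> f) > R" if "f \<in> F" for f
    proof -
      have fc: "f \<in> carrier G" using that Fc by auto
      have "inv (inv f \<otimes> t) = inv t \<otimes> f" using fc tc by (simp add: inv_mult_group)
      then show ?thesis using a[OF that] displacement_inv[of "inv f \<otimes> t" p] fc tc by simp
    qed
    have "sep (insert t F)" using F(2) a b unfolding sep_def by blast
    then have "t \<in> F" using max[of "insert t F"] t F(1) by blast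
    then show False using neg \<open>\<one> \<in> B\<close> tc by auto
  qed
  have "T' \<subseteq> (\<lambda>(f, b). f \<otimes> b) ` (F \<times> B)"
  proof
    fix t assume t: "t \<in> T'"
    then obtain f where f: "f \<in> F" "inv f \<otimes> t \<in> B" using cover by blast
    have "t \<in> carrier G" "f \<in> carrier G" using t f(1) Fc T'(2) Hc by auto
    then have "f \<otimes> (inv f \<otimes> t) = t" by (simp flip: m_assoc)
    then show "t \<in> (\<lambda>(f, b). f \<otimes> b) ` (F \<times> B)" using f by force
  qed
  then have "sum ?e T' \<le> sum ?e ((\<lambda>(f, b). f \<otimes> b) ` (F \<times> B))"
    using finF finB by (intro sum_mono2) auto
  also have "\<dots> \<le> (\<Sum>x\<in>F \<times> B. ?e (case x of (f, b) \<Rightarrow> f \<otimes> b))"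
    using sum_image_le[of "F \<times> B" ?e "\<lambda>(f, b). f \<otimes> b"] finF finB by (simp add: o_def)
  also have "\<dots> \<le> (\<Sum>(f, b)\<in>F \<times> B. ?e f * exp (w * R))"
  proof (rule sum_mono)
    fix x assume "x \<in> F \<times> B"
    then obtain f b where x: "x = (f, b)" "f \<in> F" "b \<in> B" by blast
    have c: "f \<in> carrier G" "b \<in> carrier G" "?d b \<le> R" using x Fc by (auto simp: B_def)
    have "?d f \<le> ?d (f \<otimes> b) + ?d (inv b)"
      using displacement_mult[of "f \<otimes> b" "inv b" p] c by (simp add: m_assoc)
    then have "?d f - R \<le> ?d (f \<otimes> b)" using c displacement_inv[of b p] by simp
    then have "w * (?d f - R) \<le> w * ?d (f \<otimes> b)" using w by (rule mult_left_mono)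
    then have "?e (f \<otimes> b) \<le> exp (- w * ?d f + w * R)" by (simp add: algebra_simps)
    also have "\<dots> = ?e f * exp (w * R)" by (rule exp_add)
    finally show "?e (case x of (f, b) \<Rightarrow> f \<otimes> b) \<le> (case x of (f, b) \<Rightarrow> ?e f * exp (w * R))"
      by (simp add: x(1))
  qed
  also have "\<dots> = (\<Sum>f\<in>F. \<Sum>b\<in>B. ?e f * exp (w * R))"
    by (rule sum.cartesian_product[symmetric])
  also have "\<dots> = D * sum ?e F"
    by (simp add: D_def sum_distrib_left mult_ac)
  finally have "C * D \<le> D * sum ?e F" using sT' by linarith
  then have "C \<le> sum ?e F" using D0 by (simp add: mult.commute)
  moreover have "?d f > R" if "f \<in> F" for f
    using that F(1) Fc by (auto simp: T'_def B_def)
  moreover have "F \<subseteq> H" using F(1) T'(2) by blast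
  ultimately show ?thesis using that finF F(2) unfolding sep_def by blast
qed

text \<open>Contrapositive of \<open>finite_index_of_unbounded_projections\<close>. The bound for
  the orbit of \<open>y\<close> passes to the orbit of \<open>p\<close> since projections are
  coarsely Lipschitz.\<close>

lemma exists_bounded_projection:
  assumes g: "constricting_element G act \<Gamma> g" and H: "subgroup H G"
    and idx: "infinite (rcosets H)" and qc: "quasi_convex_subgroup G act \<Gamma> H"
  obtains \<delta> A \<pi> k K where "projection_to \<Gamma> \<delta> A \<pi>" "k \<in> carrier G"
    "\<And>n::int. act (k \<otimes> g [^] n \<otimes> inv k) ` A = A"
    "\<And>h. h \<in> H \<Longrightarrow> dist (\<pi> (act h p)) p \<le> K"
proof -
  have gc: "g \<in> carrier G" "\<And>n::nat. n > 0 \<Longrightarrow> g [^] n \<noteq> \<one>"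
    using g by (auto simp: constricting_element_def)
  obtain \<delta> A \<pi> where A: "\<forall>k\<in>cyclic_subgroup G g. act k ` A = A"
    and P: "projection_to \<Gamma> \<delta> A \<pi>" and cob: "acts_coboundedly act (cyclic_subgroup G g) \<delta> A"
    using g unfolding constricting_element_def constricting_set_iff_projection by blast
  obtain \<eta> Y y where Y: "\<forall>h\<in>H. act h ` Y = Y" "quasi_convex_set \<Gamma> \<eta> Y" "acts_coboundedly act H \<eta> Y"
    and y: "y \<in> Y" using qc unfolding quasi_convex_subgroup_def by blast
  have "\<not> (\<forall>k\<in>carrier G. \<forall>v. \<exists>h\<in>H. v \<le> dist (translate k \<pi> (act h y)) (translate k \<pi> y))"
    using finite_index_of_unbounded_projections[OF P H gc cob _ Y(2,3) y] Y(1) idx by blast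
  then obtain k v where k: "k \<in> carrier G"
    and v: "\<And>h. h \<in> H \<Longrightarrow> dist (translate k \<pi> (act h y)) (translate k \<pi> y) < v"
    by (meson not_le)
  let ?\<rho> = "translate k \<pi>"
  have Q: "projection_to \<Gamma> \<delta> (act k ` A) ?\<rho>" using projection_translate[OF P k] .
  have bound: "dist (?\<rho> (act h p)) p \<le> qlen (dist p y) + 2 * \<delta> + v + dist (?\<rho> y) p" if h: "h \<in> H" for h
  proof -
    have hc: "h \<in> carrier G" using subgroup.mem_carrier[OF H h] .
    have "dist (?\<rho> (act h p)) (?\<rho> (act h y)) \<le> qlen (dist p y) + 2 * \<delta>"
      using projection_coarse_lipschitz[OF Q, of "act h p" "act h y"] hc by simp
    moreover have "dist (?\<rho> (act h p)) p \<le>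
      dist (?\<rho> (act h p)) (?\<rho> (act h y)) + dist (?\<rho> (act h y)) (?\<rho> y) + dist (?\<rho> y) p"
      using dist_triangle[of "?\<rho> (act h p)" p "?\<rho> (act h y)"] dist_triangle[of "?\<rho> (act h y)" p "?\<rho> y"]
      by linarith
    ultimately show ?thesis using v[OF h] by linarith
  qed
  have inv: "act (k \<otimes> g [^] n \<otimes> inv k) ` act k ` A = act k ` A" for n :: int
  proof -
    have "act (k \<otimes> g [^] n \<otimes> inv k) (act k a) = act k (act (g [^] n) a)" for a
      using k gc(1) by (simp add: act_mult)
    then have "act (k \<otimes> g [^] n \<otimes> inv k) ` act k ` A = act k ` act (g [^] n) ` A"
      by (simp add: image_image)
    moreover have "act (g [^] n) ` A = A" using A by (auto simp: cyclic_subgroup_def)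
    ultimately show ?thesis by simp
  qed
  show ?thesis using that[OF Q k inv bound] .
qed

text \<open>The conjugated powers are infinitely many distinct elements, and only finitely many
  elements have displacement at most \<open>L\<close>.\<close>

lemma exists_conjugate_power_displacing:
  assumes g: "g \<in> carrier G" "\<And>n::nat. n > 0 \<Longrightarrow> g [^] n \<noteq> \<one>" and k: "k \<in> carrier G"
  obtains n :: int where "dist p (act (k \<otimes> g [^] n \<otimes> inv k) p) > L"
proof -
  have "inj (\<lambda>n::int. k \<otimes> g [^] n \<otimes> inv k)"
    using int_pow_inj_of_infinite_order[OF g] g(1) k by (auto simp: inj_on_def)
  then have "infinite (range (\<lambda>n::int. k \<otimes> g [^] n \<otimes> inv k))"
    using finite_imageD infinite_UNIV_int by blast
  then have "\<not> range (\<lambda>n::int. k \<otimes> g [^] n \<otimes> inv k) \<subseteq> {x \<in> carrier G. dist p (act x p) \<le> L}"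
    using finite_displacement finite_subset by blast
  then obtain n :: int where "k \<otimes> g [^] n \<otimes> inv k \<notin> {x \<in> carrier G. dist p (act x p) \<le> L}" by blast
  then show ?thesis using that[of n] g(1) k by (auto simp: not_le)
qed

text \<open>The identity is counted in every ball of nonnegative radius, so the logarithm is
  nonnegative. With finiteness this makes the growth rate a real number.\<close>

lemma growth_rate_nonneg:
  assumes H: "subgroup H G"
  shows "0 \<le> growth_rate G act p H"
  unfolding growth_rate_def
proof (rule le_Limsup)
  show "\<forall>\<^sub>F r in at_top. 0 \<le> ereal (ln (real (card {g \<in> carrier G. dist p (act g p) \<le> r \<and> g \<in> H})) / r)"
    using eventually_gt_at_top[of 0]
  proof eventually_elim
    case (elim r)
    let ?B = "{g \<in> carrier G. dist p (act g p) \<le> r \<and> g \<in> H}"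
    have "finite ?B" by (rule finite_subset[OF _ finite_displacement[of p r]]) auto
    moreover have "\<one> \<in> ?B" using elim subgroup.one_closed[OF H] by simp
    ultimately have "card ?B > 0" using card_gt_0_iff by blast
    then show ?case using elim by simp
  qed
qed simp

theorem growth_rate_gap:
  assumes g: "constricting_element G act \<Gamma> g" and H: "subgroup H G"
    and idx: "infinite (rcosets H)" and fin: "growth_rate G act p H < \<infinity>"
    and div: "divergent_subgroup G act p H" and qc: "quasi_convex_subgroup G act \<Gamma> H"
  shows "growth_rate G act p H < growth_rate G act p (carrier G)"
proof -
  obtain w where w: "growth_rate G act p H = ereal w" "0 \<le> w"
    using fin growth_rate_nonneg[OF H, of p] by (cases "growth_rate G act p H") auto
  have gc: "g \<in> carrier G" "\<And>n::nat. n > 0 \<Longrightarrow> g [^] n \<noteq> \<one>"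
    using g by (auto simp: constricting_element_def)
  obtain \<delta> A \<pi> k K where P: "projection_to \<Gamma> \<delta> A \<pi>" and k: "k \<in> carrier G"
    and inv: "\<And>n::int. act (k \<otimes> g [^] n \<otimes> inv k) ` A = A"
    and K: "\<And>h. h \<in> H \<Longrightarrow> dist (\<pi> (act h p)) p \<le> K"
    using exists_bounded_projection[OF g H idx qc] by metis
  obtain K' R where K': "K \<le> K'" and pp: "\<And>h x. h \<in> H \<Longrightarrow> dist p (act h p) > R \<Longrightarrow>
      dist (\<pi> x) p > K' \<Longrightarrow> dist (\<pi> (act h x)) p \<le> K'"
    using ping_pong_near_set[OF P H K] by metis
  \<comment> \<open>Twice the radius of \<open>N\<close> plus the error of coarse equivariance:
    beyond this, \<open>u\<close> moves \<open>N\<close> off itself.\<close>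
  obtain n :: int where n: "dist p (act (k \<otimes> g [^] n \<otimes> inv k) p) > 2 * K' + (qlen \<delta> + 4 * \<delta>)"
    using exists_conjugate_power_displacing[OF gc k] by blast
  define u where "u = k \<otimes> g [^] n \<otimes> inv k"
  have uc: "u \<in> carrier G" using k gc(1) by (simp add: u_def)
  define N where "N = {x. dist (\<pi> x) p \<le> K'}"
  have uN: "act u x \<notin> N" if "x \<in> N" for x
  proof -
    have "dist (\<pi> (act u x)) (act u (\<pi> x)) \<le> qlen \<delta> + 4 * \<delta>"
      using projection_coarsely_equivariant[OF P uc] inv by (simp add: u_def)
    moreover have "dist (act u (\<pi> x)) (act u p) \<le> K'" using that uc by (simp add: N_def)
    moreover have "dist p (act u p) \<le>
      dist (\<pi> (act u x)) p + dist (\<pi> (act u x)) (act u (\<pi> x)) + dist (act u (\<pi> x)) (act u p)"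
      using dist_triangle2[of p "act u p" "\<pi> (act u x)"] dist_triangle[of "\<pi> (act u x)" "act u p" "act u (\<pi> x)"]
      by (simp add: dist_commute)
    ultimately show ?thesis using n by (simp add: N_def u_def)
  qed
  have HN: "act h p \<in> N" if "h \<in> H" for h using K[OF that] K' by (simp add: N_def)
  let ?d = "\<lambda>h. dist p (act h p)"
  have ns: "\<not> (\<lambda>h. exp (- w * ?d h)) summable_on H"
    using div w(1) by (simp add: divergent_subgroup_def)
  \<comment> \<open>The factor \<open>exp (w * ?d u)\<close> pays for the letter \<open>u\<close>
    after each letter of \<open>F\<close>, and the factor 2 leaves room above 1.\<close>
  obtain F where F: "finite F" "F \<subseteq> H" "\<And>f. f \<in> F \<Longrightarrow> ?d f > max R 0"
    "\<And>f f'. f \<in> F \<Longrightarrow> f' \<in> F \<Longrightarrow> f \<noteq> f' \<Longrightarrow> ?d (inv f \<otimes> f') > max R 0"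
    "2 * exp (w * ?d u) \<le> (\<Sum>f\<in>F. exp (- w * ?d f))"
    using separated_set_with_large_poincare_sum[OF H w(2) _ ns, of "max R 0" "2 * exp (w * ?d u)"]
    by (metis max.cobounded2)
  have Fc: "F \<subseteq> carrier G" using F(2) subgroup.subset[OF H] by blast
  have inj: "inj_on (alternating_word u) (lists F)"
  proof (rule ping_pong_alternating_word_inj[OF uc Fc _ uN])
    show "p \<in> N" using HN[OF subgroup.one_closed[OF H]] by simp
    show "act s x \<in> N" if "s \<in> F" "x \<notin> N" for s x
      using pp[of s x] F(2) F(3)[OF that(1)] that by (auto simp: N_def)
    show "act (inv s \<otimes> s') x \<in> N" if "s \<in> F" "s' \<in> F" "s \<noteq> s'" "x \<notin> N" for s s' x
    proof -
      have "inv s \<otimes> s' \<in> H" using that F(2) H by (auto intro: subgroup.m_closed subgroup.m_inv_closed)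
      then show ?thesis using pp[of "inv s \<otimes> s'" x] F(4)[OF that(1-3)] that(4) by (simp add: N_def)
    qed
    show "act (inv s) p \<in> N" if "s \<in> F" for s
      using HN that F(2) subgroup.m_inv_closed[OF H] by blast
  qed
  let ?P = "\<lambda>s. \<Sum>f\<in>F. exp (- s * (?d f + ?d u))"
  have "?P w = (\<Sum>f\<in>F. exp (- w * ?d f)) * exp (- w * ?d u)"
    by (simp add: sum_distrib_right distrib_left flip: exp_add)
  also have "\<dots> \<ge> 2 * exp (w * ?d u) * exp (- w * ?d u)"
    using F(5) by (rule mult_right_mono) simp
  also have "2 * exp (w * ?d u) * exp (- w * ?d u) = 2" by (simp add: exp_minus)
  finally have "1 < ?P w" by simp
  \<comment> \<open>A finite sum is continuous in the exponent, so it stays above 1 at some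
    \<open>s\<close> strictly larger than \<open>w\<close>; this makes the final inequality
    strict.\<close>
  moreover have "(?P \<longlongrightarrow> ?P w) (at_right w)" by (intro tendsto_intros)
  ultimately have "\<forall>\<^sub>F s in at_right w. 1 < ?P s" by (rule order_tendstoD(1)[rotated])
  then have "\<forall>\<^sub>F s in at_right w. 1 < ?P s \<and> w < s"
    using eventually_at_right_less by eventually_elim simp
  then obtain s where s: "1 < ?P s" "w < s"
    using eventually_happens trivial_limit_at_right_real by blast
  have "ereal s \<le> growth_rate G act p (carrier G)"
    using growth_rate_ge_of_inj_alternating_word[OF F(1) Fc uc inj, of s p] s w(2) by simp
  then show ?thesis using s(2) w(1) by (metis ereal_less_ereal_Ex order_less_le_trans less_ereal.simps(1))
qed

end

theorem mainTheorem1: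
  fixes G :: "('g, 'm) monoid_scheme"
    and act :: "'g \<Rightarrow> 'x::metric_space \<Rightarrow> 'x"
    and \<Gamma> :: "'x path set"
    and \<mu> \<nu> :: real and H :: "'g set" and x0 :: 'x
  assumes "\<mu> \<ge> 1" and "\<nu> \<ge> 0"
    and "path_system_group \<mu> \<nu> G act \<Gamma>"
    and "\<exists>g. constricting_element G act \<Gamma> g"
    and "subgroup H G" and "infinite (rcosets\<^bsub>G\<^esub> H)"
    and "growth_rate G act x0 H < \<infinity>"
    and "divergent_subgroup G act x0 H"
    and "quasi_convex_subgroup G act \<Gamma> H"
  shows "growth_rate G act x0 H < growth_rate G act x0 (carrier G)"
proof -
  interpret path_system_action G \<Gamma> \<mu> \<nu> act
    using assms(1-3)
    by (simp add: path_system_group_def path_system_action_def path_system_space_def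
        path_system_action_axioms_def)
  show ?thesis using assms(4-9) growth_rate_gap by blast
qed

end
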